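(* Assume the setting described in the context (problem $\min_x F(x)+H(g(x))$ with Assumptions 1 and 2). Let $(x^0,y^0)\in\mathrm{dom}(F)\times\mathrm{dom}(H^* )$, let $(x^\star,y^\star)$ be a saddle point of $\widetilde{\mathcal L}$, and let $D$ be any constant with $D\ge\max\{\|x^0-x^\star\|,\|y^0-y^\star\|,\|y^\star\|\}$. Define $$C:=\max\{L_f+2M_g^2+2,\ L_gD(L_gD+4M_g+2)\},\quad \rho:=1,\quad \eta:=\tfrac{\rho}{2},\quad L:=L_f+\rho(C+2M_g^2).$$ Let $\{(x^k,y^k)\}$ be generated by Algorithm 1 (see context) with, for all $k\ge0$, $$\tau_k:=1,\quad \beta_{k+1}:=0,\quad \rho_k:=\rho,\quad L_k:=L,\quad \eta_k:=\eta .$$ Let $(\bar x^k,\bar y^k):=\frac1k\sum_{j=1}^k(x^j,y^j)$. Then for all $k\ge1$: $$\mathcal P(\bar x^k)-\mathcal P^\star\le\frac1{2k}\Big[L_0\|x^0-x^\star\|^2+\frac{2}{\rho_0}\big(\|y^0\|+M_H\big)^2\Big],$$ $$\mathcal D(\bar y^k)-\mathcal D^\star\le\frac1{2k}\Big[L_0\big(\|x^0\|+M_{F^*}\big)^2+\frac{2}{\rho_0}\|y^0-y^\star\|^2\Big],$$ $$\mathcal G_{\mathcal X\times\mathcal Y}(\bar x^k,\bar y^k)\le\frac{\mathcal R^2_{\mathcal X\times\mathcal Y}}{2k},$$ where $\mathcal R^2_{\mathcal X\times\mathcal Y}:=\sup\{L_0\|x-x^0\|^2+\frac{2}{\rho_0}\|y-y^0\|^2: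 x\in\mathcal X,\ y\in\mathcal Y\}$, and $M_H,M_{F^*}\in[0,+\infty]$ are the Lipschitz constants of $H$ and $F^*$.
   Context: Setting. $\|\cdot\|$ is the Euclidean norm. $f:\mathbb R^p\to\mathbb R$ is convex and differentiable; $h:\mathbb R^p\to\mathbb R\cup\{+\infty\}$ and $H:\mathbb R^n\to\mathbb R\cup\{+\infty\}$ are proper, closed, convex; $F:=f+h$; $g:\mathbb R^p\to\mathbb R^n$ is smooth (possibly nonlinear) with Jacobian $g'(x)\in\mathbb R^{n\times p}$, and $H\circ g$ is convex. $H^*,F^*$ are Fenchel conjugates. $\mathrm{prox}_{\varphi}(x):=\arg\min_y\{\varphi(y)+\frac12\|y-x\|^2\}$. Primal: $\mathcal P(x):=F(x)+H(g(x))$, $\mathcal P^\star:=\min_x\mathcal P(x)$. Dual: $\mathcal D(y):=G(-y)+H^*(y)$ with $G(y):=\max_x\{\langle y,g(x)\rangle-F(x)\}$, $\mathcal D^\star:=\min_y\mathcal D(y)$. Lagrangian: $\widetilde{\mathcal L}(x,y):=F(x)+\langle g(x),y\rangle-H^*(y)$. Assumption 1: there is $(x^\star,y^\star)\in\mathrm{dom}(F)\times\mathrm{dom}(H^* )$ (a saddle point) with $\widetilde{\mathcal L}(x^\star,y)\le\widetilde{\mathcal L}(x^\star,y^\star)\le\widetilde{\mathcal L}(x,y^\star)$ for all $(x,y)\in\mathrm{dom}(F)\times\mathrm{dom}(H^* )$, and $\widetilde{\mathcal L}(x^\star,y^\star)$ is finite. Assumption 2: (a) $\nabla f$ is $L_f$-Lipschitz,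 $L_f\in[0,\infty)$. (b) For every $y\in\mathrm{dom}(H^* )$, $x\mapsto\langle y,g(x)\rangle$ is convex; each $g_i$ is $M_{g_i}$-Lipschitz with $M_{g_i}\in[0,\infty)$; and for every $y\in\mathrm{dom}(H^* )$ the map $x\mapsto g'(x)^\top y$ is $\mathbf L_g(y)$-Lipschitz with $0\le\mathbf L_g(y)\le L_g\|y\|$ for a uniform constant $L_g\in[0,\infty)$. Set $M_g^2:=\sum_{i=1}^nM_{g_i}^2$. Gap function: $\mathcal G_{\mathcal X\times\mathcal Y}(x,y):=\sup\{\widetilde{\mathcal L}(x,\hat y)-\widetilde{\mathcal L}(\hat x,y):\hat x\in\mathcal X,\hat y\in\mathcal Y\}$, where $\mathcal X\subseteq\mathrm{dom}(F)$, $\mathcal Y\subseteq\mathrm{dom}(H^* )$ are nonempty closed sets such that $\mathcal X\times\mathcal Y$ contains a saddle point. Lipschitz constants $M_H$, $M_{F^*}$: the Lipschitz constant over the whole space, equal to $+\infty$ if the function is not real-valued and Lipschitz there (in which case the corresponding bound is vacuous). Algorithm 1. Given $(x^0,y^0)\in\mathrm{dom}(F)\times\mathrm{dom}(H^* )$, set $\hat x^0:=x^0$, $\tilde y^0:=y^0$, $\Theta_0:=0$. For $k=0,1,2,\dots$, with parameters $\tau_k,L_k,\rho_k,\eta_k,\beta_{k+1}$: $y^{k+1}:=\mathrm{prox}_{\rho_kH^*}(\tilde y^k+\rho_kg(\hat x^k))$; $x^{k+1}:=\mathrm{prox}_{h/L_k}\big(\hat x^k-\frac1{L_k}[\nabla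 f(\hat x^k)+g'(\hat x^k)^\top y^{k+1}]\big)$; $\Theta_{k+1}:=g(x^{k+1})-g(\hat x^k)+\frac1{\rho_k}(y^{k+1}-\tilde y^k)$; $\tilde y^{k+1}:=\tilde y^k+\eta_k[\Theta_{k+1}-(1-\tau_k)\Theta_k]$; $\hat x^{k+1}:=x^{k+1}+\beta_{k+1}(x^{k+1}-x^k)$. *)

theory Defs
  imports "HOL-Analysis.Analysis"
begin

text \<open>
  Functions with values in \<open>\<real> \<union> {+\<infinity>}\<close> are modelled as \<^typ>\<open>ereal\<close>-valued functions; the value
  \<open>-\<infinity>\<close> is excluded by \<open>proper\<close>.
\<close>

definition dom_ext :: "('a \<Rightarrow> ereal) \<Rightarrow> 'a set" where
  "dom_ext \<phi> = {x. \<phi> x < \<infinity>}"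

definition epi_ext :: "('a \<Rightarrow> ereal) \<Rightarrow> ('a \<times> real) set" where
  "epi_ext \<phi> = {(x, t). \<phi> x \<le> ereal t}"

definition proper :: "('a \<Rightarrow> ereal) \<Rightarrow> bool" where
  "proper \<phi> \<longleftrightarrow> (\<forall>x. \<phi> x \<noteq> - \<infinity>) \<and> dom_ext \<phi> \<noteq> {}"

definition closed_ext :: "('a::topological_space \<Rightarrow> ereal) \<Rightarrow> bool" where
  "closed_ext \<phi> \<longleftrightarrow> closed (epi_ext \<phi>)"

definition convex_ext :: "('a::real_vector \<Rightarrow> ereal) \<Rightarrow> bool" where
  "convex_ext \<phi> \<longleftrightarrow> convex (epi_ext \<phi>)"

definition conjugate :: "('a::real_inner \<Rightarrow> ereal) \<Rightarrow> 'a \<Rightarrow> ereal" where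
  "conjugate \<phi> y = (SUP x. ereal (x \<bullet> y) - \<phi> x)"

definition prox :: "('a::real_inner \<Rightarrow> ereal) \<Rightarrow> 'a \<Rightarrow> 'a" where
  "prox \<phi> x = (ARG_MIN (\<lambda>y. \<phi> y + ereal (1/2 * (norm (y - x))\<^sup>2)) y. True)"

text \<open>
  The smallest global Lipschitz constant; \<open>Inf {} = \<infinity>\<close> yields \<open>\<infinity>\<close> when \<open>\<phi>\<close> is not real-valued or
  not Lipschitz.
\<close>

definition lipschitz_const :: "('a::metric_space \<Rightarrow> ereal) \<Rightarrow> ereal" where
  "lipschitz_const \<phi> =
     Inf {ereal M | M. (\<forall>x. \<bar>\<phi> x\<bar> \<noteq> \<infinity>) \<and> M-lipschitz_on UNIV (\<lambda>x. real_of_ereal (\<phi> x))}"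

definition primal ::
  "('a \<Rightarrow> ereal) \<Rightarrow> ('b \<Rightarrow> ereal) \<Rightarrow> ('a \<Rightarrow> 'b) \<Rightarrow> 'a \<Rightarrow> ereal" where
  "primal F H g x = F x + H (g x)"

definition primal_opt ::
  "('a \<Rightarrow> ereal) \<Rightarrow> ('b \<Rightarrow> ereal) \<Rightarrow> ('a \<Rightarrow> 'b) \<Rightarrow> ereal" where
  "primal_opt F H g = (INF x. primal F H g x)"

definition dual_G ::
  "('a \<Rightarrow> ereal) \<Rightarrow> ('a \<Rightarrow> 'b::real_inner) \<Rightarrow> 'b \<Rightarrow> ereal" where
  "dual_G F g y = (SUP x. ereal (y \<bullet> g x) - F x)"

definition dual ::
  "('a \<Rightarrow> ereal) \<Rightarrow> ('b::real_inner \<Rightarrow> ereal) \<Rightarrow> ('a \<Rightarrow> 'b) \<Rightarrow> 'b \<Rightarrow> ereal" where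
  "dual F H g y = dual_G F g (- y) + conjugate H y"

definition dual_opt ::
  "('a \<Rightarrow> ereal) \<Rightarrow> ('b::real_inner \<Rightarrow> ereal) \<Rightarrow> ('a \<Rightarrow> 'b) \<Rightarrow> ereal" where
  "dual_opt F H g = (INF y. dual F H g y)"

definition lagrangian ::
  "('a \<Rightarrow> ereal) \<Rightarrow> ('b::real_inner \<Rightarrow> ereal) \<Rightarrow> ('a \<Rightarrow> 'b) \<Rightarrow> 'a \<Rightarrow> 'b \<Rightarrow> ereal" where
  "lagrangian F H g x y = F x + ereal (g x \<bullet> y) - conjugate H y"

definition saddle_point ::
  "('a \<Rightarrow> ereal) \<Rightarrow> ('b::real_inner \<Rightarrow> ereal) \<Rightarrow> ('a \<Rightarrow> 'b) \<Rightarrow> 'a \<Rightarrow> 'b \<Rightarrow> bool" where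
  "saddle_point F H g xs ys \<longleftrightarrow>
     xs \<in> dom_ext F \<and> ys \<in> dom_ext (conjugate H) \<and>
     (\<forall>x\<in>dom_ext F. \<forall>y\<in>dom_ext (conjugate H).
        lagrangian F H g xs y \<le> lagrangian F H g xs ys \<and>
        lagrangian F H g xs ys \<le> lagrangian F H g x ys)"

definition gap ::
  "('a \<Rightarrow> ereal) \<Rightarrow> ('b::real_inner \<Rightarrow> ereal) \<Rightarrow> ('a \<Rightarrow> 'b) \<Rightarrow> 'a set \<Rightarrow> 'b set \<Rightarrow> 'a \<Rightarrow> 'b \<Rightarrow> ereal"
where
  "gap F H g X Y x y =
     Sup {lagrangian F H g x y' - lagrangian F H g x' y | x' y'. x' \<in> X \<and> y' \<in> Y}"

text \<open>
  Here \<open>grad_f\<close> stands for \<open>\<nabla>f\<close> and \<open>Jg\<close> for the Jacobian of \<open>g\<close>; \<open>xh\<close> and \<open>yt\<close> are the auxiliary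
  sequences \<open>x\<close>-hat and \<open>y\<close>-tilde.
\<close>

definition algorithm1 ::
  "(real^'p \<Rightarrow> real^'p) \<Rightarrow> (real^'p \<Rightarrow> ereal) \<Rightarrow> (real^'n \<Rightarrow> ereal) \<Rightarrow>
   (real^'p \<Rightarrow> real^'n) \<Rightarrow> (real^'p \<Rightarrow> real^'p^'n) \<Rightarrow>
   (nat \<Rightarrow> real) \<Rightarrow> (nat \<Rightarrow> real) \<Rightarrow> (nat \<Rightarrow> real) \<Rightarrow> (nat \<Rightarrow> real) \<Rightarrow> (nat \<Rightarrow> real) \<Rightarrow>
   (nat \<Rightarrow> real^'p) \<Rightarrow> (nat \<Rightarrow> real^'n) \<Rightarrow>
   (nat \<Rightarrow> real^'p) \<Rightarrow> (nat \<Rightarrow> real^'n) \<Rightarrow> (nat \<Rightarrow> real^'n) \<Rightarrow> bool" where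
  "algorithm1 grad_f h H g Jg \<tau> L \<rho> \<eta> \<beta> x y xh yt \<Theta> \<longleftrightarrow>
     xh 0 = x 0 \<and> yt 0 = y 0 \<and> \<Theta> 0 = 0 \<and>
     (\<forall>k.
        y (Suc k) = prox (\<lambda>v. ereal (\<rho> k) * conjugate H v) (yt k + \<rho> k *\<^sub>R g (xh k)) \<and>
        x (Suc k) = prox (\<lambda>u. h u / ereal (L k))
          (xh k - (1 / L k) *\<^sub>R (grad_f (xh k) + transpose (Jg (xh k)) *v y (Suc k))) \<and>
        \<Theta> (Suc k) = g (x (Suc k)) - g (xh k) + (1 / \<rho> k) *\<^sub>R (y (Suc k) - yt k) \<and>
        yt (Suc k) = yt k + \<eta> k *\<^sub>R (\<Theta> (Suc k) - (1 - \<tau> k) *\<^sub>R \<Theta> k) \<and>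
        xh (Suc k) = x (Suc k) + \<beta> (Suc k) *\<^sub>R (x (Suc k) - x k))"

definition avg :: "(nat \<Rightarrow> 'a::real_vector) \<Rightarrow> nat \<Rightarrow> 'a" where
  "avg x k = (1 / real k) *\<^sub>R (\<Sum>j=1..k. x j)"

end

theory Submission
  imports Defs
begin

text \<open>
  Let \<open>\<Theta>\<close> be the increment with \<open>yt\<^sup>+ = yt + \<Theta>/2\<close>. The optimality conditions of the two proximal
  steps, together with the descent lemma for \<open>f\<close> and for \<open>\<langle>y\<^sup>+, g\<rangle>\<close>, bound
  \<open>lag x\<^sup>+ v - lag u y\<^sup>+\<close> by the decrease of the potential \<open>L/2 \<parallel>x - u\<parallel>\<^sup>2 + \<parallel>yt - v\<parallel>\<^sup>2\<close>, provided that
  \<open>Lg \<parallel>y\<^sup>+\<parallel> \<le> C\<close>: the remaining terms \<open>\<langle>\<Theta>, \<Delta>g\<rangle> - 3/4 \<parallel>\<Theta>\<parallel>\<^sup>2 \<le> \<parallel>\<Delta>g\<parallel>\<^sup>2\<close> are absorbed by the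
  \<open>2 M\<^sup>2\<close> in \<open>L\<close>. At a saddle point the left-hand side is nonnegative, so the potential there never
  increases, and nonexpansiveness of the proximal map turns this into the required bound on \<open>y\<^sup>+\<close>; the
  induction closes by the choice of \<open>C\<close>. Summation and Jensen's inequality give the gap bound for the
  averages. For the primal bound take the supremum over \<open>v\<close> (Fenchel--Moreau), for the dual bound
  the supremum over \<open>u\<close>; Lipschitz continuity of \<open>H\<close> (of \<open>F\<^sup>*\<close>) confines the relevant \<open>v\<close>
  (\<open>u\<close>) to a ball.
\<close>

subsection \<open>Extended-real convex functions, conjugates and proximal maps\<close>

lemma dom_extI:
  assumes "\<phi> x \<le> ereal r"
  shows "x \<in> dom_ext \<phi>"
  using assms unfolding dom_ext_def by (cases "\<phi> x") auto

text \<open>A convex combination of the epigraph points over \<open>x\<close> and \<open>y\<close>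
  stays in the epigraph. This yields the inequality and also convexity of the domain, which
  \<open>convex_on\<close> includes.\<close>

lemma convex_ext_imp_convex_on:
  fixes \<phi> :: "'a::real_vector \<Rightarrow> ereal"
  assumes "proper \<phi>" "convex_ext \<phi>"
  shows "convex_on (dom_ext \<phi>) (\<lambda>x. real_of_ereal (\<phi> x))"
proof -
  have fin: "\<phi> x = ereal (real_of_ereal (\<phi> x))" if "x \<in> dom_ext \<phi>" for x
    using that assms(1) by (cases "\<phi> x") (auto simp: dom_ext_def proper_def)
  have *: "\<phi> (u *\<^sub>R x + v *\<^sub>R y) \<le> ereal (u * real_of_ereal (\<phi> x) + v * real_of_ereal (\<phi> y))"
    if "x \<in> dom_ext \<phi>" "y \<in> dom_ext \<phi>" "0 \<le> u" "0 \<le> v" "u + v = 1" for x y u v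
  proof -
    have "(x, real_of_ereal (\<phi> x)) \<in> epi_ext \<phi>" "(y, real_of_ereal (\<phi> y)) \<in> epi_ext \<phi>"
      using fin that by (auto simp: epi_ext_def)
    then have "u *\<^sub>R (x, real_of_ereal (\<phi> x)) + v *\<^sub>R (y, real_of_ereal (\<phi> y)) \<in> epi_ext \<phi>"
      using assms(2) that unfolding convex_ext_def convex_def by blast
    then show ?thesis by (simp add: epi_ext_def)
  qed
  have dom: "u *\<^sub>R x + v *\<^sub>R y \<in> dom_ext \<phi>"
    if "x \<in> dom_ext \<phi>" "y \<in> dom_ext \<phi>" "0 \<le> u" "0 \<le> v" "u + v = 1" for x y u v
    using *[OF that] by (rule dom_extI)
  show ?thesis
    unfolding convex_on_def
  proof (intro conjI ballI allI impI)
    show "convex (dom_ext \<phi>)" using dom by (auto simp: convex_def)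
    fix x y u v assume a: "x \<in> dom_ext \<phi>" "y \<in> dom_ext \<phi>" "0 \<le> (u::real)" "0 \<le> v" "u + v = 1"
    have "ereal (real_of_ereal (\<phi> (u *\<^sub>R x + v *\<^sub>R y)))
        \<le> ereal (u * real_of_ereal (\<phi> x) + v * real_of_ereal (\<phi> y))"
      using *[OF a] fin[OF dom[OF a]] by simp
    then show "real_of_ereal (\<phi> (u *\<^sub>R x + v *\<^sub>R y))
        \<le> u * real_of_ereal (\<phi> x) + v * real_of_ereal (\<phi> y)" by simp
  qed
qed

lemma proper_finite:
  assumes "proper \<phi>" "x \<in> dom_ext \<phi>"
  shows "ereal (real_of_ereal (\<phi> x)) = \<phi> x"
  using assms by (cases "\<phi> x") (auto simp: dom_ext_def proper_def)

text \<open>Being a preimage under a continuous linear map, the scaled epigraph inherits closedness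
  and convexity.\<close>

lemma epi_ext_scale:
  assumes "c > 0"
  shows "epi_ext (\<lambda>u. \<phi> u / ereal c) = (\<lambda>(u, t). (u, c * t)) -` epi_ext \<phi>"
proof -
  have "\<phi> u / ereal c \<le> ereal t \<longleftrightarrow> \<phi> u \<le> ereal (c * t)" for u t
    using assms by (simp add: ereal_divide_le_pos)
  then show ?thesis by (auto simp: epi_ext_def)
qed

lemma proper_scale:
  assumes "c > 0" "proper \<phi>"
  shows "proper (\<lambda>u. \<phi> u / ereal c)" "dom_ext (\<lambda>u. \<phi> u / ereal c) = dom_ext \<phi>"
proof -
  have "\<phi> u / ereal c = -\<infinity> \<longleftrightarrow> \<phi> u = -\<infinity>" "\<phi> u / ereal c < \<infinity> \<longleftrightarrow> \<phi> u < \<infinity>" for u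
    using assms(1) by (cases "\<phi> u"; simp)+
  then show "proper (\<lambda>u. \<phi> u / ereal c)" "dom_ext (\<lambda>u. \<phi> u / ereal c) = dom_ext \<phi>"
    using assms(2) by (auto simp: proper_def dom_ext_def)
qed

lemma closed_ext_scale:
  assumes "c > 0" "closed_ext \<phi>"
  shows "closed_ext (\<lambda>u. \<phi> u / ereal c)"
  using assms unfolding closed_ext_def epi_ext_scale[OF assms(1)]
  by (auto intro!: closed_vimage continuous_intros simp: case_prod_unfold)

lemma convex_ext_scale:
  assumes "c > 0" "convex_ext \<phi>"
  shows "convex_ext (\<lambda>u. \<phi> u / ereal c)"
proof -
  have "linear (\<lambda>(u::'a, t::real). (u, c * t))"
    by (rule linearI) (auto simp: algebra_simps)
  then show ?thesis
    using assms unfolding convex_ext_def epi_ext_scale[OF assms(1)]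
    by (intro convex_linear_vimage)
qed

section \<open>Fenchel conjugates\<close>

text \<open>A conjugate is a supremum of affine functions. For proper \<open>\<phi>\<close> each
  slice of the intersection is a closed half-space or the whole space, which makes the conjugate
  closed and convex.\<close>

lemma epi_ext_conjugate:
  "epi_ext (conjugate \<phi>) = (\<Inter>x. {(y, t). ereal (x \<bullet> y) - \<phi> x \<le> ereal t})"
  by (auto simp: epi_ext_def conjugate_def SUP_le_iff)

lemma conjugate_epi_slice:
  fixes x :: "'a::real_inner"
  assumes "\<phi> x \<noteq> - \<infinity>"
  shows "{(y, t). ereal (x \<bullet> y) - \<phi> x \<le> ereal t} =
     (if \<phi> x = \<infinity> then UNIV else {p. (x, -1) \<bullet> p \<le> real_of_ereal (\<phi> x)})"
  using assms by (cases "\<phi> x") (auto simp: algebra_simps)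

lemma closed_ext_conjugate:
  assumes "proper \<phi>"
  shows "closed_ext (conjugate \<phi>)"
  using assms unfolding closed_ext_def epi_ext_conjugate proper_def
  by (intro closed_INT ballI) (simp add: conjugate_epi_slice closed_halfspace_le)

lemma convex_ext_conjugate:
  assumes "proper \<phi>"
  shows "convex_ext (conjugate \<phi>)"
  using assms unfolding convex_ext_def epi_ext_conjugate proper_def
  by (intro convex_INT) (simp add: conjugate_epi_slice convex_halfspace_le)

text \<open>A single point of \<open>dom_ext \<phi>\<close> supplies an affine minorant of the
  conjugate, so the value -infinity cannot occur.\<close>

lemma proper_conjugate:
  assumes "proper \<phi>" "dom_ext (conjugate \<phi>) \<noteq> {}"
  shows "proper (conjugate \<phi>)"
proof -
  obtain x where x: "x \<in> dom_ext \<phi>" using assms(1) by (auto simp: proper_def)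
  have "ereal (x \<bullet> y) - \<phi> x \<le> conjugate \<phi> y" for y
    unfolding conjugate_def by (rule SUP_upper) simp
  moreover have "ereal (x \<bullet> y) - \<phi> x \<noteq> - \<infinity>" for y
    using proper_finite[OF assms(1) x] by (metis MInfty_neq_ereal(1) ereal_minus(1))
  ultimately show ?thesis
    using assms(2) unfolding proper_def by (metis ereal_infty_less_eq(2))
qed

lemma fenchel_young:
  assumes "proper \<phi>" "x \<in> dom_ext \<phi>" "y \<in> dom_ext (conjugate \<phi>)"
  shows "x \<bullet> y \<le> real_of_ereal (\<phi> x) + real_of_ereal (conjugate \<phi> y)"
proof -
  have "proper (conjugate \<phi>)" using proper_conjugate[OF assms(1)] assms(3) by blast
  then have "ereal (real_of_ereal (conjugate \<phi> y)) = conjugate \<phi> y"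
    using assms(3) by (rule proper_finite)
  moreover have "ereal (x \<bullet> y) - \<phi> x \<le> conjugate \<phi> y"
    unfolding conjugate_def by (rule SUP_upper) simp
  ultimately have "ereal (x \<bullet> y) - ereal (real_of_ereal (\<phi> x)) \<le> ereal (real_of_ereal (conjugate \<phi> y))"
    using proper_finite assms by metis
  then show ?thesis by simp
qed

lemma conjugate_le:
  assumes "proper \<phi>" "\<And>x. x \<in> dom_ext \<phi> \<Longrightarrow> x \<bullet> y - real_of_ereal (\<phi> x) \<le> B"
  shows "conjugate \<phi> y \<le> ereal B"
  unfolding conjugate_def
proof (rule SUP_least)
  fix x show "ereal (x \<bullet> y) - \<phi> x \<le> ereal B"
  proof (cases "x \<in> dom_ext \<phi>")
    case True
    then show ?thesis using assms(2)[OF True] proper_finite[OF assms(1) True] by (metis ereal_less_eq(3) ereal_minus(1))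
  next
    case False
    then have "\<phi> x = \<infinity>" by (simp add: dom_ext_def)
    then show ?thesis by simp
  qed
qed

section \<open>Separation of the epigraph and biconjugation\<close>

text \<open>A point strictly below the graph lies outside the closed convex epigraph and is strictly
  separated from it. The sign of \<open>b\<close> comes from the epigraph being unbounded
  upwards.\<close>

lemma epigraph_separation:
  fixes \<phi> :: "'a::euclidean_space \<Rightarrow> ereal"
  assumes "proper \<phi>" "closed_ext \<phi>" "convex_ext \<phi>" "ereal r < \<phi> x"
  obtains a b c where "b \<ge> 0" "a \<bullet> x + b * r < c"
    "\<And>u. u \<in> dom_ext \<phi> \<Longrightarrow> a \<bullet> u + b * real_of_ereal (\<phi> u) > c"
proof -
  have "(x, r) \<notin> epi_ext \<phi>" using assms(4) by (auto simp: epi_ext_def)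
  then obtain p c where p: "p \<bullet> (x, r) < c" "\<And>q. q \<in> epi_ext \<phi> \<Longrightarrow> p \<bullet> q > c"
    using separating_hyperplane_closed_point[of "epi_ext \<phi>" "(x, r)"] assms(2,3)
    unfolding closed_ext_def convex_ext_def by blast
  obtain a b where ab: "p = (a, b)" by fastforce
  have le: "a \<bullet> u + b * t > c" if "u \<in> dom_ext \<phi>" "real_of_ereal (\<phi> u) \<le> t" for u t
  proof -
    have "(u, t) \<in> epi_ext \<phi>" using that proper_finite[OF assms(1) that(1)]
      by (auto simp: epi_ext_def) (metis ereal_less_eq(3))
    then show ?thesis using p(2) ab by fastforce
  qed
  obtain w where w: "w \<in> dom_ext \<phi>" using assms(1) by (auto simp: proper_def)
  have "b \<ge> 0"
  proof (rule ccontr)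
    assume "\<not> b \<ge> 0"
    then have b: "b < 0" by simp
    \<comment> \<open>A height above \<open>w\<close> at which a negative \<open>b\<close> would
      push the separating functional down to \<open>c\<close> or below.\<close>
    define t where "t = max (real_of_ereal (\<phi> w)) ((c - a \<bullet> w) / b)"
    have "t \<ge> (c - a \<bullet> w) / b" by (simp add: t_def)
    then have "b * t \<le> c - a \<bullet> w" using b by (simp add: neg_divide_le_eq mult.commute)
    then show False using le[OF w, of t] by (simp add: t_def)
  qed
  then show ?thesis using that[of b a c] p(1) le ab by simp
qed

text \<open>Division by \<open>b\<close> turns a nonvertical separating hyperplane into an affine
  minorant, in the form that \<open>conjugate_le\<close> accepts.\<close>

lemma nonvertical_hyperplane_le:
  fixes a u :: "'a::real_inner" and b c r :: real
  assumes "b > 0" "a \<bullet> u + b * r > c"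
  shows "u \<bullet> (- (1 / b) *\<^sub>R a) - r \<le> - c / b"
proof -
  have "c / b < (a \<bullet> u + b * r) / b" using assms by (simp add: divide_strict_right_mono)
  then show ?thesis using assms(1) by (simp add: add_divide_distrib inner_commute)
qed

text \<open>Separating a point one unit below the graph gives a nonvertical hyperplane, hence an
  affine minorant, and its slope lies in the domain of the conjugate.\<close>

lemma dom_conjugate_nonempty:
  fixes \<phi> :: "'a::euclidean_space \<Rightarrow> ereal"
  assumes "proper \<phi>" "closed_ext \<phi>" "convex_ext \<phi>"
  shows "dom_ext (conjugate \<phi>) \<noteq> {}"
proof -
  obtain w where w: "w \<in> dom_ext \<phi>" using assms(1) by (auto simp: proper_def)
  have "ereal (real_of_ereal (\<phi> w) - 1) < ereal (real_of_ereal (\<phi> w))" by simp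
  then have lt: "ereal (real_of_ereal (\<phi> w) - 1) < \<phi> w" using proper_finite[OF assms(1) w] by simp
  obtain b a c where abc: "b \<ge> 0" "a \<bullet> w + b * (real_of_ereal (\<phi> w) - 1) < c"
      "\<And>u. u \<in> dom_ext \<phi> \<Longrightarrow> a \<bullet> u + b * real_of_ereal (\<phi> u) > c"
    by (rule epigraph_separation[OF assms lt]) (rule that)
  \<comment> \<open>Both inequalities concern points over the same \<open>w\<close>, so
    \<open>b = 0\<close> would be contradictory.\<close>
  have "b > 0" using abc(1,2) abc(3)[OF w] by (cases "b = 0") (auto simp: algebra_simps)
  have "conjugate \<phi> (- (1 / b) *\<^sub>R a) \<le> ereal (- c / b)"
  proof (rule conjugate_le[OF assms(1)])
    fix u assume "u \<in> dom_ext \<phi>"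
    then show "u \<bullet> (- (1 / b) *\<^sub>R a) - real_of_ereal (\<phi> u) \<le> - c / b"
      using nonvertical_hyperplane_le[OF \<open>b > 0\<close> abc(3)] by simp
  qed
  then have "- (1 / b) *\<^sub>R a \<in> dom_ext (conjugate \<phi>)" by (rule dom_extI)
  then show ?thesis by blast
qed

text \<open>The hypothesis says that every affine minorant of \<open>\<phi>\<close> is at most
  \<open>B\<close> at \<open>x\<close>. Were \<open>B\<close> below \<open>\<phi> x\<close>, a
  hyperplane separating \<open>(x, B)\<close> from the epigraph would produce a minorant exceeding
  \<open>B\<close> there.\<close>

lemma fenchel_moreau_le:
  fixes \<phi> :: "'a::euclidean_space \<Rightarrow> ereal"
  assumes pcc: "proper \<phi>" "closed_ext \<phi>" "convex_ext \<phi>"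
    and B: "\<And>y. y \<in> dom_ext (conjugate \<phi>) \<Longrightarrow> x \<bullet> y - real_of_ereal (conjugate \<phi> y) \<le> B"
  shows "\<phi> x \<le> ereal B"
proof (rule ccontr)
  assume "\<not> \<phi> x \<le> ereal B"
  then have lt: "ereal B < \<phi> x" by simp
  obtain b a c where abc: "b \<ge> 0" "a \<bullet> x + b * B < c"
      "\<And>u. u \<in> dom_ext \<phi> \<Longrightarrow> a \<bullet> u + b * real_of_ereal (\<phi> u) > c"
    by (rule epigraph_separation[OF pcc lt]) (rule that)
  \<comment> \<open>The offset \<open>\<beta>\<close> of an affine minorant with slope
    \<open>y\<close> is at least the conjugate at \<open>y\<close>, so \<open>B\<close> caps its
    value at \<open>x\<close>.\<close>
  have bound: "x \<bullet> y - \<beta> \<le> B"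
    if "\<And>u. u \<in> dom_ext \<phi> \<Longrightarrow> u \<bullet> y - real_of_ereal (\<phi> u) \<le> \<beta>" for y \<beta>
  proof -
    have le: "conjugate \<phi> y \<le> ereal \<beta>" using conjugate_le[OF pcc(1) that] .
    then have y: "y \<in> dom_ext (conjugate \<phi>)" by (rule dom_extI)
    then have "ereal (real_of_ereal (conjugate \<phi> y)) = conjugate \<phi> y"
      using proper_conjugate[OF pcc(1)] by (intro proper_finite) auto
    then have "real_of_ereal (conjugate \<phi> y) \<le> \<beta>" using le by (metis ereal_less_eq(3))
    then show ?thesis using B[OF y] by simp
  qed
  show False
  proof (cases "b = 0")
    case False
    then have "b > 0" using abc(1) by simp
    have "x \<bullet> (- (1 / b) *\<^sub>R a) - (- c / b) \<le> B"
    proof (rule bound)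
      fix u assume "u \<in> dom_ext \<phi>"
      then show "u \<bullet> (- (1 / b) *\<^sub>R a) - real_of_ereal (\<phi> u) \<le> - c / b"
        using nonvertical_hyperplane_le[OF \<open>b > 0\<close> abc(3)] by simp
    qed
    then show False using abc(2) \<open>b > 0\<close> by (simp add: field_simps inner_commute)
  next
    case True
    \<comment> \<open>A vertical hyperplane is no minorant by itself; it is used to tilt an existing
      minorant with slope \<open>z\<close>.\<close>
    obtain z where z: "z \<in> dom_ext (conjugate \<phi>)" using dom_conjugate_nonempty[OF pcc] by blast
    define \<zeta> where "\<zeta> = real_of_ereal (conjugate \<phi> z)"
    \<comment> \<open>Large enough that the tilted minorant reaches at least \<open>B + 1\<close> at
      \<open>x\<close>.\<close>
    define s where "s = max 0 ((B - x \<bullet> z + \<zeta> + 1) / (c - a \<bullet> x))"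
    have pos: "c - a \<bullet> x > 0" using abc(2) True by simp
    have s: "s \<ge> 0" "s * (c - a \<bullet> x) \<ge> B - x \<bullet> z + \<zeta> + 1"
      using pos by (auto simp: s_def pos_divide_le_eq[symmetric])
    have "x \<bullet> (z - s *\<^sub>R a) - (\<zeta> - s * c) \<le> B"
    proof (rule bound)
      fix u assume u: "u \<in> dom_ext \<phi>"
      have "s * c \<le> s * (a \<bullet> u)" using abc(3)[OF u] True s(1) by (intro mult_left_mono) auto
      then show "u \<bullet> (z - s *\<^sub>R a) - real_of_ereal (\<phi> u) \<le> \<zeta> - s * c"
        using fenchel_young[OF pcc(1) u z] by (simp add: \<zeta>_def inner_diff_right inner_commute)
    qed
    then show False using s(2) by (simp add: inner_diff_right inner_commute algebra_simps)
  qed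
qed

section \<open>Proximal points\<close>

text \<open>The minimization is moved to the epigraph, where the objective \<open>\<psi>\<close> is
  continuous. An affine minorant of \<open>\<phi>\<close> grows too slowly to offset the quadratic,
  so the sublevel set \<open>S\<close> is compact.\<close>

lemma prox_minimizer_exists:
  fixes \<phi> :: "'a::euclidean_space \<Rightarrow> ereal"
  assumes pcc: "proper \<phi>" "closed_ext \<phi>" "convex_ext \<phi>"
  shows "\<exists>p. is_arg_min (\<lambda>y. \<phi> y + ereal (1/2 * (norm (y - v))\<^sup>2)) (\<lambda>_. True) p"
proof -
  obtain w where w: "w \<in> dom_ext \<phi>" using pcc(1) by (auto simp: proper_def)
  obtain a where a: "a \<in> dom_ext (conjugate \<phi>)" using dom_conjugate_nonempty[OF pcc] by blast
  define \<alpha> where "\<alpha> = real_of_ereal (conjugate \<phi> a)"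
  define \<psi> where "\<psi> = (\<lambda>(y, t). t + 1/2 * (norm (y - v))\<^sup>2)"
  define r where "r = \<psi> (w, real_of_ereal (\<phi> w))"
  define S where "S = {p \<in> epi_ext \<phi>. \<psi> p \<le> r}"
  have in_epi: "(y, real_of_ereal (\<phi> y)) \<in> epi_ext \<phi>" if "y \<in> dom_ext \<phi>" for y
    using proper_finite[OF pcc(1) that] by (simp add: epi_ext_def)
  have cont: "continuous_on UNIV \<psi>" unfolding \<psi>_def case_prod_unfold by (intro continuous_intros)
  have "closed S"
  proof -
    have "S = epi_ext \<phi> \<inter> \<psi> -` {..r}" by (auto simp: S_def)
    moreover have "closed (\<psi> -` {..r})" using cont closed_vimage by blast
    ultimately show ?thesis using pcc(2) by (simp add: closed_ext_def closed_Int)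
  qed
  moreover have "bounded S"
  proof -
    define K where "K = r + \<alpha> - a \<bullet> v"
    define R where "R = 1 + 2 * (norm a + \<bar>K\<bar>)"
    have "norm (y - v) \<le> R \<and> t \<in> {- norm a * R + a \<bullet> v - \<alpha> .. r}" if "(y, t) \<in> S" for y t
    proof -
      have yt: "\<phi> y \<le> ereal t" "t + 1/2 * (norm (y - v))\<^sup>2 \<le> r"
        using that by (auto simp: S_def epi_ext_def \<psi>_def)
      then have y: "y \<in> dom_ext \<phi>" by (blast intro: dom_extI)
      have "a \<bullet> y - \<alpha> \<le> real_of_ereal (\<phi> y)"
        using fenchel_young[OF pcc(1) y a] by (simp add: \<alpha>_def inner_commute)
      moreover have "real_of_ereal (\<phi> y) \<le> t" using yt(1) proper_finite[OF pcc(1) y] by (metis ereal_less_eq(3))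
      moreover have "a \<bullet> (y - v) \<ge> - (norm a * norm (y - v))"
        using Cauchy_Schwarz_ineq2[of a "y - v"] by linarith
      ultimately have t: "t \<ge> - (norm a * norm (y - v)) + a \<bullet> v - \<alpha>"
        by (simp add: inner_diff_right)
      have R: "norm (y - v) \<le> R"
      proof (cases "norm (y - v) \<le> 1")
        case True
        moreover have "R \<ge> 1" by (simp add: R_def)
        ultimately show ?thesis by linarith
      next
        case False
        then have n: "norm (y - v) > 1" by simp
        have "1/2 * (norm (y - v))\<^sup>2 \<le> norm a * norm (y - v) + K"
          using t yt(2) by (simp add: K_def)
        \<comment> \<open>The norm exceeds 1 here, so the constant is absorbed into a linear term
          and one factor of the norm cancels.\<close>
        also have "K \<le> \<bar>K\<bar> * norm (y - v)"
          using n mult_left_mono[of 1 "norm (y - v)" "\<bar>K\<bar>"] by simp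
        finally have "norm (y - v) * norm (y - v) \<le> (2 * (norm a + \<bar>K\<bar>)) * norm (y - v)"
          by (simp add: power2_eq_square algebra_simps)
        then have "norm (y - v) \<le> 2 * (norm a + \<bar>K\<bar>)" by (rule mult_right_le_imp_le) (use n in linarith)
        then show ?thesis by (simp add: R_def)
      qed
      have "norm a * norm (y - v) \<le> norm a * R" using R by (simp add: mult_left_mono)
      moreover have "t \<le> r" using yt(2) zero_le_power2[of "norm (y - v)"] by linarith
      ultimately show ?thesis using R t by simp
    qed
    then have "S \<subseteq> cball v R \<times> {- norm a * R + a \<bullet> v - \<alpha> .. r}"
      by (force simp: dist_norm norm_minus_commute)
    then show ?thesis
      by (rule bounded_subset[OF bounded_Times[OF bounded_cball bounded_closed_interval]])
  qed
  ultimately have "compact S" by (simp add: compact_eq_bounded_closed)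
  moreover have w_S: "(w, real_of_ereal (\<phi> w)) \<in> S" using in_epi[OF w] by (simp add: S_def r_def)
  moreover have "continuous_on S \<psi>" using cont continuous_on_subset by blast
  ultimately obtain q where q: "q \<in> S" "\<And>q'. q' \<in> S \<Longrightarrow> \<psi> q \<le> \<psi> q'"
    by (metis continuous_attains_inf empty_iff)
  obtain p t where pt: "q = (p, t)" by fastforce
  have "\<not> \<phi> u + ereal (1/2 * (norm (u - v))\<^sup>2) < \<phi> p + ereal (1/2 * (norm (p - v))\<^sup>2)" for u
  proof (cases "u \<in> dom_ext \<phi>")
    case True
    \<comment> \<open>Pairs over the domain but outside \<open>S\<close> have values above
      \<open>r\<close>, the value at the pair over \<open>w\<close>, which lies in
      \<open>S\<close>.\<close>
    have "\<psi> q \<le> \<psi> (u, real_of_ereal (\<phi> u))"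
    proof (cases "\<psi> (u, real_of_ereal (\<phi> u)) \<le> r")
      case True
      then show ?thesis using q(2) in_epi[OF \<open>u \<in> dom_ext \<phi>\<close>] by (simp add: S_def)
    next
      case False
      then show ?thesis using q(2)[OF w_S] by (simp add: r_def)
    qed
    then have "ereal t + ereal (1/2 * (norm (p - v))\<^sup>2) \<le> \<phi> u + ereal (1/2 * (norm (u - v))\<^sup>2)"
      using proper_finite[OF pcc(1) True, symmetric] by (cases "\<phi> u") (simp_all add: pt \<psi>_def)
    moreover have "\<phi> p \<le> ereal t" using q(1) by (simp add: S_def pt epi_ext_def)
    then have "\<phi> p + ereal (1/2 * (norm (p - v))\<^sup>2) \<le> ereal t + ereal (1/2 * (norm (p - v))\<^sup>2)"
      by (rule add_right_mono)
    ultimately show ?thesis by (meson leD order_trans)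
  next
    case False
    then show ?thesis by (simp add: dom_ext_def)
  qed
  then show ?thesis unfolding is_arg_min_def by blast
qed

text \<open>First-order optimality: compare the proximal point with points on the segment towards
  \<open>u\<close>, divide by \<open>t\<close> and let \<open>t\<close> tend to 0 from the
  right.\<close>

lemma prox_variational:
  fixes \<phi> :: "'a::euclidean_space \<Rightarrow> ereal"
  assumes pcc: "proper \<phi>" "closed_ext \<phi>" "convex_ext \<phi>"
  shows "prox \<phi> v \<in> dom_ext \<phi>"
    and "u \<in> dom_ext \<phi> \<Longrightarrow>
      real_of_ereal (\<phi> (prox \<phi> v)) + (v - prox \<phi> v) \<bullet> (u - prox \<phi> v) \<le> real_of_ereal (\<phi> u)"
proof -
  define p where "p = prox \<phi> v"
  let ?\<phi> = "\<lambda>u. real_of_ereal (\<phi> u)"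
  \<comment> \<open>\<open>prox\<close> is defined by choice, so it denotes a minimizer only once
    existence is known.\<close>
  have "is_arg_min (\<lambda>y. \<phi> y + ereal (1/2 * (norm (y - v))\<^sup>2)) (\<lambda>_. True) p"
    using prox_minimizer_exists[OF pcc] unfolding p_def prox_def arg_min_def by (rule someI_ex)
  then have min: "\<phi> p + ereal (1/2 * (norm (p - v))\<^sup>2) \<le> \<phi> y + ereal (1/2 * (norm (y - v))\<^sup>2)" for y
    by (auto simp: is_arg_min_def not_less)
  obtain w where w: "w \<in> dom_ext \<phi>" using pcc(1) by (auto simp: proper_def)
  show p: "prox \<phi> v \<in> dom_ext \<phi>"
    using min[of w] proper_finite[OF pcc(1) w] unfolding p_def[symmetric] dom_ext_def
    by (cases "\<phi> p"; cases "\<phi> w") auto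
  assume u: "u \<in> dom_ext \<phi>"
  note conv = convex_ext_imp_convex_on[OF pcc(1,3)]
  have minr: "?\<phi> p + 1/2 * (norm (p - v))\<^sup>2 \<le> ?\<phi> y + 1/2 * (norm (y - v))\<^sup>2" if "y \<in> dom_ext \<phi>" for y
    using min[of y] proper_finite[OF pcc(1) that] proper_finite[OF pcc(1) p] unfolding p_def
    by (metis ereal_less_eq(3) plus_ereal.simps(1))
  have step: "?\<phi> p + (v - p) \<bullet> (u - p) \<le> ?\<phi> u + t / 2 * (norm (u - p))\<^sup>2" if t: "0 < t" "t \<le> 1" for t
  proof -
    define y where "y = (1 - t) *\<^sub>R p + t *\<^sub>R u"
    have y: "y \<in> dom_ext \<phi>" "?\<phi> y \<le> (1 - t) * ?\<phi> p + t * ?\<phi> u"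
      using conv p u t unfolding convex_on_def convex_def y_def p_def by auto
    have *: "y - v = (p - v) + t *\<^sub>R (u - p)" by (simp add: y_def algebra_simps)
    have "(norm (y - v))\<^sup>2 = (norm (p - v))\<^sup>2 + 2 * t * ((p - v) \<bullet> (u - p)) + t\<^sup>2 * (norm (u - p))\<^sup>2"
      unfolding power2_norm_eq_inner * inner_add_left inner_add_right
      by (simp add: inner_commute power2_eq_square)
    then have "t * ?\<phi> p \<le> t * ?\<phi> u + t * ((p - v) \<bullet> (u - p)) + t\<^sup>2 / 2 * (norm (u - p))\<^sup>2"
      using minr[OF y(1)] y(2) by (simp add: algebra_simps)
    also have "\<dots> = t * (?\<phi> u + (p - v) \<bullet> (u - p) + t / 2 * (norm (u - p))\<^sup>2)"
      by (simp add: algebra_simps power2_eq_square)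
    finally have "?\<phi> p \<le> ?\<phi> u + (p - v) \<bullet> (u - p) + t / 2 * (norm (u - p))\<^sup>2" using t by simp
    moreover have "(p - v) \<bullet> (u - p) = - ((v - p) \<bullet> (u - p))" by (simp add: inner_diff_left)
    ultimately show ?thesis by simp
  qed
  have "((\<lambda>t. ?\<phi> u + t / 2 * (norm (u - p))\<^sup>2) \<longlongrightarrow> ?\<phi> u + 0 / 2 * (norm (u - p))\<^sup>2) (at_right 0)"
    by (intro tendsto_intros) auto
  moreover have "\<forall>\<^sub>F t in at_right (0::real). ?\<phi> p + (v - p) \<bullet> (u - p) \<le> ?\<phi> u + t / 2 * (norm (u - p))\<^sup>2"
    unfolding eventually_at_right_field using step by (intro exI[of _ 1]) auto
  ultimately have "?\<phi> p + (v - p) \<bullet> (u - p) \<le> ?\<phi> u + 0 / 2 * (norm (u - p))\<^sup>2"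
    by (intro tendsto_lowerbound) auto
  then show "?\<phi> (prox \<phi> v) + (v - prox \<phi> v) \<bullet> (u - prox \<phi> v) \<le> ?\<phi> u" by (simp add: p_def)
qed

subsection \<open>Smooth convex functions\<close>

lemma has_real_derivative_along_line:
  fixes f :: "'a::real_inner \<Rightarrow> real"
  assumes "\<And>u. GDERIV f u :> df u"
  shows "((\<lambda>t. f (a + t *\<^sub>R d)) has_real_derivative df (a + t *\<^sub>R d) \<bullet> d) (at t within S)"
proof -
  have outer: "(f has_derivative (\<lambda>h. h \<bullet> df (a + t *\<^sub>R d))) (at (a + t *\<^sub>R d) within (\<lambda>t. a + t *\<^sub>R d) ` S)"
    using assms unfolding gderiv_def by (blast intro: has_derivative_at_withinI)
  have inner: "((\<lambda>t. a + t *\<^sub>R d) has_derivative (\<lambda>s. s *\<^sub>R d)) (at t within S)"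
    by (auto intro!: derivative_eq_intros)
  have "((\<lambda>t. f (a + t *\<^sub>R d)) has_derivative (\<lambda>s. (s *\<^sub>R d) \<bullet> df (a + t *\<^sub>R d))) (at t within S)"
    by (rule has_derivative_in_compose[OF inner outer])
  then show ?thesis
    unfolding has_field_derivative_def by (simp add: inner_commute mult_commute_abs)
qed

lemma descent_lemma:
  fixes f :: "'a::real_inner \<Rightarrow> real"
  assumes df: "\<And>u. GDERIV f u :> df u" and lip: "l-lipschitz_on UNIV df"
  shows "f b \<le> f a + df a \<bullet> (b - a) + l / 2 * (norm (b - a))\<^sup>2"
proof -
  define d where "d = b - a"
  \<comment> \<open>The claim is \<open>r 1 \<le> r 0\<close>; Cauchy-Schwarz and the Lipschitz
    gradient make the derivative of \<open>r\<close> nonpositive on the unit interval.\<close>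
  define r where "r = (\<lambda>t. f (a + t *\<^sub>R d) - t * (df a \<bullet> d) - l / 2 * (norm d)\<^sup>2 * t\<^sup>2)"
  have "\<exists>D. (r has_real_derivative D) (at t) \<and> D \<le> 0" if "0 \<le> t" "t \<le> 1" for t
  proof (intro exI conjI)
    show "(r has_real_derivative df (a + t *\<^sub>R d) \<bullet> d - df a \<bullet> d - l * (norm d)\<^sup>2 * t) (at t)"
      unfolding r_def by (auto intro!: derivative_eq_intros has_real_derivative_along_line df)
    have "(df (a + t *\<^sub>R d) - df a) \<bullet> d \<le> norm (df (a + t *\<^sub>R d) - df a) * norm d"
      by (rule norm_cauchy_schwarz)
    also have "\<dots> \<le> (l * (t * norm d)) * norm d"
      using lipschitz_onD[OF lip, of "a + t *\<^sub>R d" a] that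
      by (intro mult_right_mono) (auto simp: dist_norm)
    finally show "df (a + t *\<^sub>R d) \<bullet> d - df a \<bullet> d - l * (norm d)\<^sup>2 * t \<le> 0"
      by (simp add: inner_diff_left power2_eq_square algebra_simps)
  qed
  then have "r 1 \<le> r 0" by (intro DERIV_nonpos_imp_nonincreasing[of 0 1 r]) auto
  then show ?thesis by (simp add: r_def d_def)
qed

lemma convex_gradient_inequality:
  fixes f :: "'a::real_inner \<Rightarrow> real"
  assumes df: "\<And>u. GDERIV f u :> df u" and conv: "convex_on UNIV f"
  shows "f a + df a \<bullet> (c - a) \<le> f c"
proof -
  have "convex_on UNIV (\<lambda>t. f (a + t *\<^sub>R (c - a)))"
  proof (rule convex_onI)
    fix t x y :: real assume "0 < t" "t < 1"
    have *: "a + ((1 - t) *\<^sub>R x + t *\<^sub>R y) *\<^sub>R (c - a)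
        = (1 - t) *\<^sub>R (a + x *\<^sub>R (c - a)) + t *\<^sub>R (a + y *\<^sub>R (c - a))"
      by (simp add: algebra_simps)
    show "f (a + ((1 - t) *\<^sub>R x + t *\<^sub>R y) *\<^sub>R (c - a))
        \<le> (1 - t) * f (a + x *\<^sub>R (c - a)) + t * f (a + y *\<^sub>R (c - a))"
      unfolding * using convex_onD[OF conv, of t] \<open>0 < t\<close> \<open>t < 1\<close> by simp
  qed simp
  then have "f (a + 1 *\<^sub>R (c - a)) - f (a + 0 *\<^sub>R (c - a)) \<ge> (df (a + 0 *\<^sub>R (c - a)) \<bullet> (c - a)) * (1 - 0)"
    by (rule convex_on_imp_above_tangent[where A = UNIV])
       (auto intro!: has_real_derivative_along_line[OF df] simp del: scaleR_zero_left)
  then show ?thesis by simp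
qed

text \<open>The descent lemma from \<open>a\<close> to \<open>b\<close> is combined with the tangent
  at \<open>a\<close> evaluated at \<open>c\<close>. Later \<open>a\<close> is the current iterate,
  \<open>b\<close> the next one and \<open>c\<close> an arbitrary comparison point.\<close>

lemma convex_smooth_upper_bound:
  fixes f :: "'a::real_inner \<Rightarrow> real"
  assumes df: "\<And>u. GDERIV f u :> df u" and "convex_on UNIV f" "l-lipschitz_on UNIV df"
  shows "f b \<le> f c + df a \<bullet> (b - c) + l / 2 * (norm (b - a))\<^sup>2"
  using descent_lemma[OF df assms(3), of b a] convex_gradient_inequality[OF df assms(2), of a c]
  by (simp add: inner_diff_right)

lemma norm_lipschitz_components:
  fixes g :: "'a::real_normed_vector \<Rightarrow> real^'n"
  assumes "\<And>i. (m i)-lipschitz_on UNIV (\<lambda>u. g u $ i)"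
  shows "norm (g u - g w) \<le> sqrt (\<Sum>i\<in>UNIV. (m i)\<^sup>2) * norm (u - w)"
proof -
  have "(\<Sum>i\<in>UNIV. ((g u - g w) $ i)\<^sup>2) \<le> (\<Sum>i\<in>UNIV. (m i)\<^sup>2) * (norm (u - w))\<^sup>2"
    unfolding sum_distrib_right
  proof (rule sum_mono)
    fix i
    have "\<bar>g u $ i - g w $ i\<bar> \<le> m i * norm (u - w)"
      using lipschitz_onD[OF assms, of u w] by (simp add: dist_norm)
    from power_mono[OF this, of 2] show "((g u - g w) $ i)\<^sup>2 \<le> (m i)\<^sup>2 * (norm (u - w))\<^sup>2"
      by (simp add: power_mult_distrib)
  qed
  then have "norm (g u - g w) \<le> sqrt ((\<Sum>i\<in>UNIV. (m i)\<^sup>2) * (norm (u - w))\<^sup>2)"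
    unfolding norm_vec_def L2_set_def by simp
  then show ?thesis by (simp add: real_sqrt_mult)
qed

lemma convex_on_mean:
  fixes \<phi> :: "'c::real_vector \<Rightarrow> real"
  assumes "convex_on S \<phi>" "k \<ge> 1" "\<And>j. j \<in> {1..k} \<Longrightarrow> z j \<in> S"
  shows "(1 / real k) *\<^sub>R (\<Sum>j=1..k. z j) \<in> S"
    and "\<phi> ((1 / real k) *\<^sub>R (\<Sum>j=1..k. z j)) \<le> (\<Sum>j=1..k. \<phi> (z j)) / k"
proof -
  have "convex S" using assms(1) by (simp add: convex_on_def)
  then have "(\<Sum>j\<in>{1..k}. (1 / real k) *\<^sub>R z j) \<in> S"
    using assms by (intro convex_sum) auto
  then show "(1 / real k) *\<^sub>R (\<Sum>j=1..k. z j) \<in> S" by (simp add: scaleR_sum_right)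
  have "\<phi> (\<Sum>j\<in>{1..k}. (1 / real k) *\<^sub>R z j) \<le> (\<Sum>j\<in>{1..k}. 1 / real k * \<phi> (z j))"
    using assms by (intro convex_on_sum) auto
  then show "\<phi> ((1 / real k) *\<^sub>R (\<Sum>j=1..k. z j)) \<le> (\<Sum>j=1..k. \<phi> (z j)) / k"
    by (simp add: scaleR_sum_right sum_divide_distrib)
qed

subsection \<open>The iteration on the effective domains\<close>

text \<open>A real-valued abstraction: proximal steps enter only through their variational
  inequalities, \<open>f\<close> and \<open>g\<close> through three-point upper models.
  \<open>J a v\<close> plays the role of the transposed Jacobian at \<open>a\<close> applied to
  \<open>v\<close>; the values \<open>\<rho> = 1\<close> and \<open>\<eta> = 1/2\<close> are already
  substituted.\<close>

locale saddle_iteration =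
  fixes A :: "'a::real_inner set" and B :: "'b::real_inner set"
    and f h :: "'a \<Rightarrow> real" and Hs :: "'b \<Rightarrow> real" and g :: "'a \<Rightarrow> 'b"
    and df :: "'a \<Rightarrow> 'a" and J :: "'a \<Rightarrow> 'b \<Rightarrow> 'a"
    and Lf Lg M D C L :: real and xs :: 'a and ys :: 'b
    and x :: "nat \<Rightarrow> 'a" and y yt :: "nat \<Rightarrow> 'b"
  assumes nonneg: "0 \<le> Lf" "0 \<le> Lg" "0 \<le> M"
    and f_model: "f b \<le> f c + df a \<bullet> (b - c) + Lf / 2 * (norm (b - a))\<^sup>2"
    and g_model: "v \<in> B \<Longrightarrow>
      v \<bullet> g b \<le> v \<bullet> g c + J a v \<bullet> (b - c) + Lg * norm v / 2 * (norm (b - a))\<^sup>2"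
    and g_lip: "norm (g b - g c) \<le> M * norm (b - c)"
    and D: "norm (x 0 - xs) \<le> D" "norm (y 0 - ys) \<le> D" "norm ys \<le> D"
    and C_def: "C = max (Lf + 2 * M\<^sup>2 + 2) (Lg * D * (Lg * D + 4 * M + 2))"
    and L_def: "L = Lf + C + 2 * M\<^sup>2"
    and saddle_mem: "xs \<in> A" "ys \<in> B"
    and saddle_x: "u \<in> A \<Longrightarrow> f xs + h xs + g xs \<bullet> ys \<le> f u + h u + g u \<bullet> ys"
    and saddle_y: "v \<in> B \<Longrightarrow> g xs \<bullet> v - Hs v \<le> g xs \<bullet> ys - Hs ys"
    and yt_0: "yt 0 = y 0"
    and y_mem: "y (Suc k) \<in> B" and x_mem: "x (Suc k) \<in> A"
    and y_step: "v \<in> B \<Longrightarrow>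
      Hs (y (Suc k)) + (yt k + g (x k) - y (Suc k)) \<bullet> (v - y (Suc k)) \<le> Hs v"
    and x_step: "u \<in> A \<Longrightarrow> h (x (Suc k))
        + (L *\<^sub>R (x k - x (Suc k)) - df (x k) - J (x k) (y (Suc k))) \<bullet> (u - x (Suc k)) \<le> h u"
    and yt_step: "yt (Suc k) = yt k + (1/2) *\<^sub>R (g (x (Suc k)) - g (x k) + (y (Suc k) - yt k))"
    and convex_A: "convex_on A h" and convex_B: "convex_on B Hs"
    and convex_f: "convex_on UNIV f" and convex_g: "v \<in> B \<Longrightarrow> convex_on UNIV (\<lambda>u. v \<bullet> g u)"
begin

definition lag :: "'a \<Rightarrow> 'b \<Rightarrow> real" where
  "lag u v = f u + h u + g u \<bullet> v - Hs v"

text \<open>The dual term measures the auxiliary sequence \<open>yt\<close>; its weight 1 is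
  \<open>1 / (2 * \<eta>)\<close> for \<open>\<eta> = 1/2\<close>.\<close>

definition pot :: "'a \<Rightarrow> 'b \<Rightarrow> nat \<Rightarrow> real" where
  "pot u v k = L / 2 * (norm (x k - u))\<^sup>2 + (norm (yt k - v))\<^sup>2"

lemma C_ge: "Lf + 2 * M\<^sup>2 + 2 \<le> C" "Lg * D * (Lg * D + 4 * M + 2) \<le> C"
  unfolding C_def by auto

lemma D_nonneg: "0 \<le> D" using D(3) norm_ge_zero[of ys] by linarith

section \<open>Descent of the potential\<close>

lemma one_step:
  assumes u: "u \<in> A" and v: "v \<in> B" and bound: "Lg * norm (y (Suc k)) \<le> C"
  shows "lag (x (Suc k)) v - lag u (y (Suc k)) \<le> pot u v k - pot u v (Suc k)"
proof -
  define x0 x1 y1 t0 t1 where d: "x0 = x k" "x1 = x (Suc k)" "y1 = y (Suc k)" "t0 = yt k" "t1 = yt (Suc k)"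
  define \<Delta> where "\<Delta> = g x1 - g x0"
  define \<Theta> where "\<Theta> = \<Delta> + (y1 - t0)"
  have t1: "t1 = t0 + (1/2) *\<^sub>R \<Theta>" using yt_step[of k] by (simp add: d \<Theta>_def \<Delta>_def)
  \<comment> \<open>\<open>\<Theta>\<close> is the correction that allows the dual step, computed
    with \<open>g x0\<close>, to be read at \<open>g x1\<close>.\<close>
  have "Hs y1 + (g x1 - \<Theta>) \<bullet> (v - y1) \<le> Hs v"
  proof -
    have "t0 + g x0 - y1 = g x1 - \<Theta>" by (simp add: \<Theta>_def \<Delta>_def)
    then show ?thesis using y_step[OF v, of k] by (simp add: d)
  qed
  then have dual: "g x1 \<bullet> v - Hs v \<le> g x1 \<bullet> y1 - Hs y1 + \<Theta> \<bullet> (v - y1)"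
    by (simp add: inner_diff_left inner_diff_right)
  have "f x1 + h x1 + y1 \<bullet> g x1 \<le> f u + h u + y1 \<bullet> g u - L * ((x0 - x1) \<bullet> (u - x1))
     + (Lf + Lg * norm y1) / 2 * (norm (x1 - x0))\<^sup>2"
    using x_step[OF u, of k] f_model[of x1 u x0] g_model[OF y_mem, of k x1 u x0]
    unfolding d[symmetric]
    by (simp add: inner_diff_left inner_diff_right algebra_simps add_divide_distrib)
  moreover have "- L * ((x0 - x1) \<bullet> (u - x1))
      = L / 2 * ((norm (x0 - u))\<^sup>2 - (norm (x1 - u))\<^sup>2 - (norm (x1 - x0))\<^sup>2)"
    unfolding power2_norm_eq_inner
    by (simp add: inner_diff_left inner_diff_right inner_commute algebra_simps)
  ultimately have primal: "f x1 + h x1 + g x1 \<bullet> y1 \<le> f u + h u + g u \<bullet> y1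
     + L / 2 * ((norm (x0 - u))\<^sup>2 - (norm (x1 - u))\<^sup>2)
     - (L - Lf - Lg * norm y1) / 2 * (norm (x1 - x0))\<^sup>2"
    by (simp add: inner_commute algebra_simps add_divide_distrib diff_divide_distrib)
  \<comment> \<open>Eliminating \<open>y1\<close> and \<open>t1\<close> leaves a telescoping
    difference and an error; the step length 1/2 changes the coefficient of
    \<open>\<Theta> \<bullet> \<Theta>\<close> from -1 to -3/4.\<close>
  have "\<Theta> \<bullet> (v - y1) = (norm (t0 - v))\<^sup>2 - (norm (t1 - v))\<^sup>2 + (\<Theta> \<bullet> \<Delta> - 3/4 * (\<Theta> \<bullet> \<Theta>))"
  proof -
    have y1: "y1 = t0 + \<Theta> - \<Delta>" by (simp add: \<Theta>_def)
    show ?thesis unfolding t1 y1 power2_norm_eq_inner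
      by (simp add: inner_diff_left inner_diff_right inner_add_left inner_add_right inner_commute algebra_simps)
  qed
  moreover have "\<Theta> \<bullet> \<Delta> - 3/4 * (\<Theta> \<bullet> \<Theta>) \<le> M\<^sup>2 * (norm (x1 - x0))\<^sup>2"
  proof -
    \<comment> \<open>Young's inequality, weighted to spend only a quarter of
      \<open>\<Theta> \<bullet> \<Theta>\<close>.\<close>
    have "0 \<le> ((1/2) *\<^sub>R \<Theta> - \<Delta>) \<bullet> ((1/2) *\<^sub>R \<Theta> - \<Delta>)" by (rule inner_ge_zero)
    then have "\<Theta> \<bullet> \<Delta> \<le> 1/4 * (\<Theta> \<bullet> \<Theta>) + \<Delta> \<bullet> \<Delta>"
      by (simp add: inner_diff_left inner_diff_right inner_commute)
    moreover have "\<Delta> \<bullet> \<Delta> \<le> M\<^sup>2 * (norm (x1 - x0))\<^sup>2"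
      using power_mono[OF g_lip[of x1 x0], of 2] by (simp add: \<Delta>_def power2_norm_eq_inner[of "g x1 - g x0"] power_mult_distrib)
    moreover have "0 \<le> \<Theta> \<bullet> \<Theta>" by simp
    ultimately show ?thesis by linarith
  qed
  \<comment> \<open>By the choice of \<open>L\<close> the coefficient on the right is
    \<open>C - Lg * norm y1\<close> plus twice the square of \<open>M\<close>, all over 2.\<close>
  moreover have "(2 * M\<^sup>2) / 2 * (norm (x1 - x0))\<^sup>2 \<le> (L - Lf - Lg * norm y1) / 2 * (norm (x1 - x0))\<^sup>2"
    using bound by (intro mult_right_mono divide_right_mono) (auto simp: L_def d)
  ultimately show ?thesis
    using primal dual unfolding lag_def pot_def d[symmetric]
    by (simp add: algebra_simps add_divide_distrib diff_divide_distrib)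
qed

text \<open>Since \<open>ys\<close> is itself the proximal point of \<open>ys + g xs\<close>, nonexpansiveness bounds the new dual
  iterate by quantities of the previous step only.\<close>

lemma dual_iterate_distance:
  "norm (y (Suc k) - ys) \<le> norm (yt k - ys) + M * norm (x k - xs)"
proof -
  define z where "z = y (Suc k) - ys"
  define w where "w = (yt k - ys) + (g (x k) - g xs)"
  \<comment> \<open>Add the proximal inequality tested at \<open>ys\<close> to the saddle inequality
    tested at the new dual iterate; the values of \<open>Hs\<close> cancel.\<close>
  have "z \<bullet> z \<le> w \<bullet> z"
    using y_step[OF saddle_mem(2), of k] saddle_y[OF y_mem[of k]]
    by (simp add: z_def w_def inner_diff_left inner_diff_right inner_add_left inner_commute algebra_simps)
  also have "\<dots> \<le> norm w * norm z" by (rule norm_cauchy_schwarz)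
  finally have "norm z * norm z \<le> norm w * norm z" by (simp add: power2_norm_eq_inner[symmetric] power2_eq_square)
  then have "norm z \<le> norm w" by (cases "z = 0") (auto simp: mult_le_cancel_right)
  also have "\<dots> \<le> norm (yt k - ys) + M * norm (x k - xs)"
    unfolding w_def using norm_triangle_ineq g_lip[of "x k" xs] by (meson add_left_mono order_trans)
  finally show ?thesis by (simp add: z_def)
qed

text \<open>With \<open>q = Lg D\<close> and \<open>s = sqrt C\<close>, the potential bound \<open>C D\<^sup>2\<close> gives \<open>\<parallel>y\<parallel> \<le> D (1 + s + 2 M)\<close>,
  and \<open>s\<^sup>2 \<ge> q (q + 4 M + 2)\<close> is exactly what is needed for \<open>q (1 + s + 2 M) \<le> s\<^sup>2\<close>.\<close>

lemma dual_iterate_bound: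
  assumes "pot xs ys k \<le> C * D\<^sup>2"
  shows "Lg * norm (y (Suc k)) \<le> C"
proof -
  define q s where qs: "q = Lg * D" "s = sqrt C"
  have C2: "C \<ge> 2" using C_ge(1) nonneg(1) zero_le_power2[of M] by linarith
  have LC: "L \<ge> C" using nonneg(1) zero_le_power2[of M] by (simp add: L_def)
  have s2: "s\<^sup>2 = C" "s > 0" using C2 by (auto simp: qs)
  have Lpos: "0 \<le> L / 2 * (norm (x k - xs))\<^sup>2" using LC C2 by simp
  have "(norm (yt k - ys))\<^sup>2 \<le> (s * D)\<^sup>2"
    using assms Lpos unfolding pot_def by (simp add: power_mult_distrib s2)
  then have a: "norm (yt k - ys) \<le> s * D" by (rule power2_le_imp_le) (use s2 D_nonneg in simp)
  have "C / 2 * (norm (x k - xs))\<^sup>2 \<le> L / 2 * (norm (x k - xs))\<^sup>2"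
    using LC by (intro mult_right_mono) auto
  also have "\<dots> \<le> C * D\<^sup>2" using assms zero_le_power2[of "norm (yt k - ys)"] unfolding pot_def by linarith
  finally have "C * (norm (x k - xs))\<^sup>2 \<le> C * (2 * D\<^sup>2)" by simp
  then have "(norm (x k - xs))\<^sup>2 \<le> 2 * D\<^sup>2" by (rule mult_left_le_imp_le) (use C2 in simp)
  \<comment> \<open>Enlarging the factor \<open>sqrt 2\<close> to 2 matches the term
    \<open>4 * M\<close> in \<open>C\<close>.\<close>
  also have "\<dots> \<le> (2 * D)\<^sup>2" by (simp add: power_mult_distrib)
  finally have b: "norm (x k - xs) \<le> 2 * D" by (rule power2_le_imp_le) (use D_nonneg in simp)
  have "norm (y (Suc k)) \<le> norm (y (Suc k) - ys) + norm ys" using norm_triangle_ineq[of "y (Suc k) - ys" ys] by simp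
  also have "\<dots> \<le> s * D + M * (2 * D) + D"
    using dual_iterate_distance[of k] a D(3) mult_left_mono[OF b nonneg(3)] by linarith
  finally have "Lg * norm (y (Suc k)) \<le> Lg * (s * D + M * (2 * D) + D)" using nonneg(2) by (rule mult_left_mono)
  also have "\<dots> = q * s + q * (2 * M + 1)" by (simp add: qs algebra_simps)
  also have "\<dots> \<le> s\<^sup>2"
  proof -
    have c: "q\<^sup>2 + 2 * (q * (2 * M + 1)) \<le> s\<^sup>2" using C_ge(2) by (simp add: s2 qs power2_eq_square algebra_simps)
    have "q * s \<le> (q\<^sup>2 + s\<^sup>2) / 2" using zero_le_power2[of "q - s"] by (simp add: power2_diff field_simps)
    then have "q * s \<le> q\<^sup>2 / 2 + s\<^sup>2 / 2" by (simp add: add_divide_distrib)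
    then show ?thesis using c by argo
  qed
  finally show ?thesis by (simp add: s2)
qed

text \<open>The descent needs a bound on the new dual iterate, and that bound follows from the
  potential at the preceding index. Induction therefore alternates between the two.\<close>

lemma pot_saddle_bound: "pot xs ys k \<le> C * D\<^sup>2"
proof (induction k)
  case 0
  note facts = C_ge(1) nonneg(1) zero_le_power2[of M]
  \<comment> \<open>After inserting \<open>L\<close>, this is the first lower bound on
    \<open>C\<close>.\<close>
  have "L / 2 + 1 \<le> C" using facts unfolding L_def by argo
  have "0 \<le> L" using facts unfolding L_def by argo
  have "pot xs ys 0 \<le> L / 2 * D\<^sup>2 + D\<^sup>2"
    unfolding pot_def yt_0 using D \<open>0 \<le> L\<close> by (intro add_mono mult_left_mono power_mono) auto
  also have "\<dots> = (L / 2 + 1) * D\<^sup>2" by (simp add: algebra_simps)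
  also have "\<dots> \<le> C * D\<^sup>2" using \<open>L / 2 + 1 \<le> C\<close> by (intro mult_right_mono) auto
  finally show ?case .
next
  case (Suc k)
  have "0 \<le> lag (x (Suc k)) ys - lag xs (y (Suc k))"
    using saddle_x[OF x_mem[of k]] saddle_y[OF y_mem[of k]] by (simp add: lag_def)
  then show ?case using one_step[OF saddle_mem dual_iterate_bound[OF Suc]] Suc by linarith
qed

section \<open>Telescoping and averaging\<close>

text \<open>The bound on the dual iterates, obtained from the saddle point alone, makes
  \<open>one_step\<close> available for every comparison pair, so the decreases telescope.\<close>

lemma sum_gap:
  assumes "u \<in> A" "v \<in> B"
  shows "(\<Sum>j=1..k. lag (x j) v - lag u (y j)) \<le> pot u v 0 - pot u v k"
proof (induction k)
  case (Suc k)
  then show ?case using one_step[OF assms dual_iterate_bound[OF pot_saddle_bound[of k]]] by simp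
qed simp

text \<open>On the domains \<open>lag\<close> is convex in its first and concave in its second
  argument, so Jensen's inequality passes from the summed gap to the averages.\<close>

lemma average_gap:
  assumes k: "k \<ge> 1" and u: "u \<in> A" and v: "v \<in> B"
  defines "xa \<equiv> (1 / real k) *\<^sub>R (\<Sum>j=1..k. x j)" and "ya \<equiv> (1 / real k) *\<^sub>R (\<Sum>j=1..k. y j)"
  shows "xa \<in> A" "ya \<in> B"
    and "lag xa v - lag u ya \<le> (L * (norm (x 0 - u))\<^sup>2 + 2 * (norm (y 0 - v))\<^sup>2) / (2 * real k)"
proof -
  have xA: "x j \<in> A" and yB: "y j \<in> B" if "j \<in> {1..k}" for j
    using that x_mem y_mem by (cases j; simp)+
  have cx: "convex_on A (\<lambda>u. (f u + h u) + v \<bullet> g u)"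
  proof -
    have "convex A" using convex_A by (simp add: convex_on_def)
    then have "convex_on A f" "convex_on A (\<lambda>u. v \<bullet> g u)"
      using convex_f convex_g[OF v] by (auto intro: convex_on_subset)
    then show ?thesis using convex_A by (intro convex_on_add)
  qed
  have cy: "convex_on B (\<lambda>v. Hs v + (- g u) \<bullet> v)"
    using convex_B
    by (intro convex_on_add) (auto simp: convex_on_def inner_add_right)
  show "xa \<in> A" "ya \<in> B" unfolding xa_def ya_def
    using convex_on_mean(1)[OF convex_A k xA] convex_on_mean(1)[OF convex_B k yB] by auto
  have mx: "f xa + h xa + v \<bullet> g xa \<le> (\<Sum>j=1..k. f (x j) + h (x j) + v \<bullet> g (x j)) / k"
    unfolding xa_def by (rule convex_on_mean(2)[OF cx k xA])
  have my: "Hs ya + (- g u) \<bullet> ya \<le> (\<Sum>j=1..k. Hs (y j) + (- g u) \<bullet> y j) / k"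
    unfolding ya_def by (rule convex_on_mean(2)[OF cy k yB])
  have "lag xa v - lag u ya = (f xa + h xa + v \<bullet> g xa) + (Hs ya + (- g u) \<bullet> ya) - Hs v - (f u + h u)"
    by (simp add: lag_def inner_commute)
  also have "\<dots> \<le> (\<Sum>j=1..k. f (x j) + h (x j) + v \<bullet> g (x j)) / k
      + (\<Sum>j=1..k. Hs (y j) + (- g u) \<bullet> y j) / k - Hs v - (f u + h u)"
    using mx my by linarith
  also have "\<dots> = (\<Sum>j=1..k. lag (x j) v - lag u (y j)) / k"
    using k by (simp add: lag_def inner_commute sum.distrib sum_subtractf sum_negf field_simps)
  also have "\<dots> \<le> pot u v 0 / k"
  proof (rule divide_right_mono)
    \<comment> \<open>Nonnegativity of \<open>L\<close> allows the final potential to be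
      dropped.\<close>
    have "0 \<le> L" using C_ge(1) nonneg(1) zero_le_power2[of M] unfolding L_def by linarith
    then have "0 \<le> pot u v k" by (simp add: pot_def)
    then show "(\<Sum>j=1..k. lag (x j) v - lag u (y j)) \<le> pot u v 0" using sum_gap[OF u v, of k] by linarith
  qed simp
  also have "\<dots> = (L * (norm (x 0 - u))\<^sup>2 + 2 * (norm (y 0 - v))\<^sup>2) / (2 * real k)"
    using k by (simp add: pot_def yt_0 field_simps)
  finally show "lag xa v - lag u ya \<le> \<dots>" .
qed

end

subsection \<open>Convergence rates\<close>

text \<open>Slopes of affine minorants cannot exceed a Lipschitz constant: along the ray through
  \<open>y\<close> the minorant grows at rate \<open>norm y\<close>, the function at rate at most
  \<open>M\<close>. The conjugate's domain thus lies in a ball.\<close>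

lemma norm_le_lipschitz_const:
  fixes \<phi> :: "'a::real_inner \<Rightarrow> ereal"
  assumes "\<And>x. ereal (x \<bullet> y) \<le> \<phi> x + ereal c"
  shows "ereal (norm y) \<le> lipschitz_const \<phi>"
  unfolding lipschitz_const_def
proof (rule Inf_greatest, clarify)
  fix M assume fin: "\<forall>x. \<bar>\<phi> x\<bar> \<noteq> \<infinity>" and lip: "M-lipschitz_on UNIV (\<lambda>x. real_of_ereal (\<phi> x))"
  have real: "x \<bullet> y \<le> real_of_ereal (\<phi> x) + c" for x
  proof -
    obtain r where "\<phi> x = ereal r" using fin[rule_format, of x] by (cases "\<phi> x") auto
    then show ?thesis using assms[of x] by simp
  qed
  define K where "K = real_of_ereal (\<phi> 0) + c"
  have M: "M \<ge> 0" using lip by (rule lipschitz_on_nonneg)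
  have le: "t * (norm y * (norm y - M)) \<le> K" if "t > 0" for t
  proof -
    have "\<bar>real_of_ereal (\<phi> (t *\<^sub>R y)) - real_of_ereal (\<phi> 0)\<bar> \<le> M * (t * norm y)"
      using lipschitz_onD[OF lip, of "t *\<^sub>R y" 0] that by (simp add: dist_norm)
    then show ?thesis using real[of "t *\<^sub>R y"]
      by (simp add: K_def power2_norm_eq_inner[symmetric] power2_eq_square algebra_simps)
  qed
  show "ereal (norm y) \<le> ereal M"
  proof (rule ccontr)
    assume "\<not> ereal (norm y) \<le> ereal M"
    then have pos: "norm y * (norm y - M) > 0" using M by (intro mult_pos_pos) auto
    define e where "e = norm y * (norm y - M)"
    \<comment> \<open>This point of the ray is far enough out to give the contradiction
      \<open>\<bar>K\<bar> + 1 \<le> K\<close>.\<close>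
    have "(\<bar>K\<bar> + 1) / e * e \<le> K"
      using pos unfolding e_def by (intro le divide_pos_pos) auto
    then show False using pos unfolding e_def[symmetric] by simp
  qed
qed

lemma ereal_add_square_mono:
  assumes "0 \<le> a" "0 \<le> b" "ereal b \<le> m"
  shows "ereal ((a + b)\<^sup>2) \<le> (ereal a + m)\<^sup>2"
proof -
  have "ereal (a + b) \<le> ereal a + m" using add_left_mono[OF assms(3), of "ereal a"] by simp
  then have "ereal (a + b) * ereal (a + b) \<le> (ereal a + m) * (ereal a + m)"
    using assms(1,2) by (intro ereal_mult_mono) (auto intro: order_trans[of 0 "ereal (a + b)"])
  then show ?thesis by (simp add: power2_eq_square)
qed

lemma power2_norm_diff_le: "(norm (a - b))\<^sup>2 \<le> (norm a + norm b)\<^sup>2"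
  by (intro power_mono norm_triangle_ineq4) auto

lemma gderiv_inner_jacobian:
  fixes g :: "real^'p \<Rightarrow> real^'n"
  assumes "(g has_derivative (\<lambda>d. J *v d)) (at u)"
  shows "GDERIV (\<lambda>u. v \<bullet> g u) u :> transpose J *v v"
proof -
  have "((\<lambda>u. v \<bullet> g u) has_derivative (\<lambda>d. v \<bullet> (J *v d))) (at u)"
    by (rule has_derivative_inner_right[OF assms])
  moreover have "v \<bullet> (J *v d) = d \<bullet> (transpose J *v v)" for d
    by (metis dot_lmul_matrix inner_commute transpose_matrix_vector)
  ultimately show ?thesis unfolding gderiv_def by simp
qed

text \<open>Multiplying the variational inequality of the rescaled function by \<open>c\<close>
  restores \<open>\<phi>\<close> and isolates the gradient term \<open>b\<close>.\<close>

lemma prox_scaled_variational: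
  fixes \<phi> :: "'a::euclidean_space \<Rightarrow> ereal"
  assumes c: "c > 0" and pcc: "proper \<phi>" "closed_ext \<phi>" "convex_ext \<phi>"
    and p_def: "p = prox (\<lambda>u. \<phi> u / ereal c) (a - (1 / c) *\<^sub>R b)"
  shows "p \<in> dom_ext \<phi>"
    and "u \<in> dom_ext \<phi> \<Longrightarrow>
      real_of_ereal (\<phi> p) + (c *\<^sub>R (a - p) - b) \<bullet> (u - p) \<le> real_of_ereal (\<phi> u)"
proof -
  note var = prox_variational[OF proper_scale(1) closed_ext_scale convex_ext_scale, OF c pcc(1) c pcc(2) c pcc(3),
      where v = "a - (1 / c) *\<^sub>R b", folded p_def, unfolded proper_scale(2)[OF c pcc(1)]]
  show "p \<in> dom_ext \<phi>" by (rule var(1))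
  assume "u \<in> dom_ext \<phi>"
  have div: "real_of_ereal (\<phi> w / ereal c) = real_of_ereal (\<phi> w) / c" for w
    using c by (cases "\<phi> w") auto
  have "real_of_ereal (\<phi> p) / c + (a - (1 / c) *\<^sub>R b - p) \<bullet> (u - p) \<le> real_of_ereal (\<phi> u) / c"
    using var(2)[OF \<open>u \<in> dom_ext \<phi>\<close>] unfolding div .
  then have "c * (real_of_ereal (\<phi> p) / c + (a - (1 / c) *\<^sub>R b - p) \<bullet> (u - p)) \<le> c * (real_of_ereal (\<phi> u) / c)"
    using c by (intro mult_left_mono) auto
  moreover have "c *\<^sub>R (a - (1 / c) *\<^sub>R b - p) = c *\<^sub>R (a - p) - b"
    using c by (simp add: algebra_simps)
  then have "c * ((a - (1 / c) *\<^sub>R b - p) \<bullet> (u - p)) = (c *\<^sub>R (a - p) - b) \<bullet> (u - p)"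
    by (metis inner_scaleR_left)
  ultimately show "real_of_ereal (\<phi> p) + (c *\<^sub>R (a - p) - b) \<bullet> (u - p) \<le> real_of_ereal (\<phi> u)"
    using c by (simp add: distrib_left)
qed

section \<open>Primal, dual and gap bounds for the averaged iterates\<close>

theorem theorem3p2:
  fixes f :: "real^'p \<Rightarrow> real" and grad_f :: "real^'p \<Rightarrow> real^'p"
    and h F :: "real^'p \<Rightarrow> ereal" and H :: "real^'n \<Rightarrow> ereal"
    and g :: "real^'p \<Rightarrow> real^'n" and Jg :: "real^'p \<Rightarrow> real^'p^'n"
    and L\<^sub>f L\<^sub>g M\<^sub>g D C \<rho> \<eta> L :: real and Mg :: "'n \<Rightarrow> real" and Lg :: "real^'n \<Rightarrow> real"
    and xstar :: "real^'p" and ystar :: "real^'n"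
    and X :: "(real^'p) set" and Y :: "(real^'n) set"
    and \<tau>\<^sub>k L\<^sub>k \<rho>\<^sub>k \<eta>\<^sub>k \<beta>\<^sub>k :: "nat \<Rightarrow> real"
    and x xh :: "nat \<Rightarrow> real^'p" and y yt \<Theta> :: "nat \<Rightarrow> real^'n"
  \<comment> \<open>setting\<close>
  assumes f_convex: "convex_on UNIV f"
    and f_gradient: "\<And>u. GDERIV f u :> grad_f u"
    and h_pcc: "proper h" "closed_ext h" "convex_ext h"
    and H_pcc: "proper H" "closed_ext H" "convex_ext H"
    and F_def: "F = (\<lambda>u. ereal (f u) + h u)"
    and g_jacobian: "\<And>u. (g has_derivative (\<lambda>d. Jg u *v d)) (at u)"
    and g_smooth: "continuous_on UNIV Jg"
    and Hg_convex: "convex_ext (\<lambda>u. H (g u))"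
  \<comment> \<open>Assumption 1\<close>
    and saddle_exists:
      "\<exists>u v. saddle_point F H g u v \<and> \<bar>lagrangian F H g u v\<bar> \<noteq> \<infinity>"
  \<comment> \<open>Assumption 2\<close>
    and grad_f_lipschitz: "L\<^sub>f-lipschitz_on UNIV grad_f"
    and yg_convex: "\<And>v. v \<in> dom_ext (conjugate H) \<Longrightarrow> convex_on UNIV (\<lambda>u. v \<bullet> g u)"
    and g_lipschitz: "\<And>i. (Mg i)-lipschitz_on UNIV (\<lambda>u. g u $ i)"
    and Jg_lipschitz: "\<And>v. v \<in> dom_ext (conjugate H) \<Longrightarrow>
          (Lg v)-lipschitz_on UNIV (\<lambda>u. transpose (Jg u) *v v)"
    and Lg_bound: "\<And>v. v \<in> dom_ext (conjugate H) \<Longrightarrow> 0 \<le> Lg v \<and> Lg v \<le> L\<^sub>g * norm v"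
    and L\<^sub>g_nonneg: "0 \<le> L\<^sub>g"
    and M\<^sub>g_def: "M\<^sub>g = sqrt (\<Sum>i\<in>UNIV. (Mg i)\<^sup>2)"
  \<comment> \<open>sets of the gap function\<close>
    and X: "X \<noteq> {}" "closed X" "X \<subseteq> dom_ext F"
    and Y: "Y \<noteq> {}" "closed Y" "Y \<subseteq> dom_ext (conjugate H)"
    and XY_saddle: "\<exists>u\<in>X. \<exists>v\<in>Y. saddle_point F H g u v"
  \<comment> \<open>initial and saddle points, parameters, iterates\<close>
    and init: "x 0 \<in> dom_ext F" "y 0 \<in> dom_ext (conjugate H)"
    and star: "saddle_point F H g xstar ystar"
    and D_bound: "D \<ge> Max {norm (x 0 - xstar), norm (y 0 - ystar), norm ystar}"
    and C_def: "C = max (L\<^sub>f + 2 * M\<^sub>g\<^sup>2 + 2) (L\<^sub>g * D * (L\<^sub>g * D + 4 * M\<^sub>g + 2))"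
    and \<rho>_def: "\<rho> = 1"
    and \<eta>_def: "\<eta> = \<rho> / 2"
    and L_def: "L = L\<^sub>f + \<rho> * (C + 2 * M\<^sub>g\<^sup>2)"
    and params: "\<And>k. \<tau>\<^sub>k k = 1" "\<And>k. \<beta>\<^sub>k (Suc k) = 0" "\<And>k. \<rho>\<^sub>k k = \<rho>" "\<And>k. L\<^sub>k k = L" "\<And>k. \<eta>\<^sub>k k = \<eta>"
    and iterates: "algorithm1 grad_f h H g Jg \<tau>\<^sub>k L\<^sub>k \<rho>\<^sub>k \<eta>\<^sub>k \<beta>\<^sub>k x y xh yt \<Theta>"
  shows "\<forall>k\<ge>1.
     primal F H g (avg x k) - primal_opt F H g
       \<le> ereal (1 / (2 * real k)) *
          (ereal (L\<^sub>k 0 * (norm (x 0 - xstar))\<^sup>2)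
           + ereal (2 / \<rho>\<^sub>k 0) * (ereal (norm (y 0)) + lipschitz_const H)\<^sup>2)
   \<and> dual F H g (avg y k) - dual_opt F H g
       \<le> ereal (1 / (2 * real k)) *
          (ereal (L\<^sub>k 0) * (ereal (norm (x 0)) + lipschitz_const (conjugate F))\<^sup>2
           + ereal (2 / \<rho>\<^sub>k 0 * (norm (y 0 - ystar))\<^sup>2))
   \<and> gap F H g X Y (avg x k) (avg y k)
       \<le> ereal (1 / (2 * real k)) *
          Sup {ereal (L\<^sub>k 0 * (norm (u - x 0))\<^sup>2 + 2 / \<rho>\<^sub>k 0 * (norm (v - y 0))\<^sup>2)
               | u v. u \<in> X \<and> v \<in> Y}"
proof (intro allI impI)
  fix k :: nat assume k: "1 \<le> k"
  define hr where "hr = (\<lambda>u. real_of_ereal (h u))"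
  define Hs where "Hs = (\<lambda>v. real_of_ereal (conjugate H v))"
  define A where "A = dom_ext h"
  define B where "B = dom_ext (conjugate H)"
  have dom_F: "dom_ext F = A"
    unfolding F_def A_def dom_ext_def by (rule Collect_cong) (case_tac "h x", auto)
  have F_real: "F u = ereal (f u + hr u)" if "u \<in> A" for u
    using proper_finite[OF h_pcc(1), of u] that unfolding F_def hr_def A_def by (metis plus_ereal.simps(1))
  have F_infty: "F u = \<infinity>" if "u \<notin> A" for u
    using that unfolding F_def A_def dom_ext_def by simp
  have ys: "ystar \<in> B" and xs: "xstar \<in> A" using star dom_F by (auto simp: saddle_point_def B_def)
  have pcc_Hs: "proper (conjugate H)" "closed_ext (conjugate H)" "convex_ext (conjugate H)"
    using proper_conjugate[OF H_pcc(1)] closed_ext_conjugate[OF H_pcc(1)]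
      convex_ext_conjugate[OF H_pcc(1)] ys by (auto simp: B_def)
  have Hs_real: "conjugate H v = ereal (Hs v)" if "v \<in> B" for v
    using proper_finite[OF pcc_Hs(1), of v] that by (simp add: B_def Hs_def)
  have Hs_infty: "conjugate H v = \<infinity>" if "v \<notin> B" for v
    using that by (simp add: B_def dom_ext_def)
  have lagrangian_real: "lagrangian F H g u v = ereal (f u + hr u + g u \<bullet> v - Hs v)"
    if "u \<in> A" "v \<in> B" for u v
    using that by (simp add: lagrangian_def F_real Hs_real)
  have saddle: "f xstar + hr xstar + g xstar \<bullet> v - Hs v \<le> f xstar + hr xstar + g xstar \<bullet> ystar - Hs ystar"
      "f xstar + hr xstar + g xstar \<bullet> ystar - Hs ystar \<le> f u + hr u + g u \<bullet> ystar - Hs ystar"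
    if "u \<in> A" "v \<in> B" for u v
    using star that xs ys unfolding saddle_point_def dom_F B_def[symmetric]
    by (metis ereal_less_eq(3) lagrangian_real)+
  have L_eq: "L = L\<^sub>f + C + 2 * M\<^sub>g\<^sup>2" by (simp add: L_def \<rho>_def)
  have Lf_nonneg: "0 \<le> L\<^sub>f" using grad_f_lipschitz by (rule lipschitz_on_nonneg)
  have L_pos: "0 < L"
  proof -
    have "L\<^sub>f + 2 * M\<^sub>g\<^sup>2 + 2 \<le> C" unfolding C_def by simp
    then show ?thesis using Lf_nonneg zero_le_power2[of M\<^sub>g] unfolding L_eq by linarith
  qed
  note alg = iterates[unfolded algorithm1_def params \<rho>_def \<eta>_def]
  \<comment> \<open>With zero extrapolation \<open>xh\<close> coincides with \<open>x\<close>; index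
    0 is covered by the initialization.\<close>
  have xh: "xh j = x j" for j
    using alg params(2) by (cases j) auto
  have y_prox: "y (Suc j) = prox (conjugate H) (yt j + g (x j))" for j
    using alg by (simp add: xh one_ereal_def[symmetric])
  have x_prox: "x (Suc j) = prox (\<lambda>u. h u / ereal L)
      (x j - (1 / L) *\<^sub>R (grad_f (x j) + transpose (Jg (x j)) *v y (Suc j)))" for j
    using alg by (simp add: xh)
  have yt_rec: "yt (Suc j) = yt j + (1/2) *\<^sub>R (g (x (Suc j)) - g (x j) + (y (Suc j) - yt j))" for j
    using alg by (simp add: xh)
  interpret saddle_iteration A B f hr Hs g grad_f "\<lambda>u v. transpose (Jg u) *v v"
    L\<^sub>f L\<^sub>g M\<^sub>g D C L xstar ystar x y yt
  proof
    show "0 \<le> L\<^sub>f" "0 \<le> L\<^sub>g" using Lf_nonneg L\<^sub>g_nonneg by auto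
    show "0 \<le> M\<^sub>g" unfolding M\<^sub>g_def by (simp add: sum_nonneg)
    show "f b \<le> f c + grad_f a \<bullet> (b - c) + L\<^sub>f / 2 * (norm (b - a))\<^sup>2" for a b c
      by (rule convex_smooth_upper_bound[OF f_gradient f_convex grad_f_lipschitz])
    show "v \<bullet> g b \<le> v \<bullet> g c + (transpose (Jg a) *v v) \<bullet> (b - c) + L\<^sub>g * norm v / 2 * (norm (b - a))\<^sup>2"
      if "v \<in> B" for v a b c
    proof -
      have v: "v \<in> dom_ext (conjugate H)" using that by (simp add: B_def)
      have "v \<bullet> g b \<le> v \<bullet> g c + (transpose (Jg a) *v v) \<bullet> (b - c) + Lg v / 2 * (norm (b - a))\<^sup>2"
        by (rule convex_smooth_upper_bound[OF gderiv_inner_jacobian[OF g_jacobian]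
              yg_convex[OF v] Jg_lipschitz[OF v]])
      also have "Lg v / 2 * (norm (b - a))\<^sup>2 \<le> L\<^sub>g * norm v / 2 * (norm (b - a))\<^sup>2"
        using Lg_bound[OF v] by (intro mult_right_mono) auto
      finally show ?thesis by simp
    qed
    show "norm (g b - g c) \<le> M\<^sub>g * norm (b - c)" for b c
      unfolding M\<^sub>g_def by (rule norm_lipschitz_components[OF g_lipschitz])
    show "norm (x 0 - xstar) \<le> D" "norm (y 0 - ystar) \<le> D" "norm ystar \<le> D"
      using D_bound by auto
    show "f xstar + hr xstar + g xstar \<bullet> ystar \<le> f u + hr u + g u \<bullet> ystar" if "u \<in> A" for u
      using saddle(2)[OF that ys] by simp
    show "g xstar \<bullet> v - Hs v \<le> g xstar \<bullet> ystar - Hs ystar" if "v \<in> B" for v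
      using saddle(1)[OF xs that] by simp
    show "yt 0 = y 0" using alg by simp
    show "y (Suc j) \<in> B" for j
      unfolding y_prox B_def by (rule prox_variational(1)[OF pcc_Hs])
    show "Hs (y (Suc j)) + (yt j + g (x j) - y (Suc j)) \<bullet> (v - y (Suc j)) \<le> Hs v" if "v \<in> B" for v j
      unfolding y_prox Hs_def using that unfolding B_def by (rule prox_variational(2)[OF pcc_Hs])
    show "x (Suc j) \<in> A" for j
      unfolding A_def by (rule prox_scaled_variational(1)[OF L_pos h_pcc x_prox])
    show "hr (x (Suc j)) + (L *\<^sub>R (x j - x (Suc j)) - grad_f (x j) - transpose (Jg (x j)) *v y (Suc j))
        \<bullet> (u - x (Suc j)) \<le> hr u" if "u \<in> A" for u j
      using prox_scaled_variational(2)[OF L_pos h_pcc x_prox[of j], of u] that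
      by (simp add: A_def hr_def diff_diff_eq)
    show "convex_on A hr" unfolding A_def hr_def by (rule convex_ext_imp_convex_on[OF h_pcc(1,3)])
    show "convex_on B Hs" unfolding B_def Hs_def by (rule convex_ext_imp_convex_on[OF pcc_Hs(1,3)])
    show "convex_on UNIV (\<lambda>u. v \<bullet> g u)" if "v \<in> B" for v using yg_convex that by (simp add: B_def)
  qed (use C_def L_eq xs ys f_convex yt_rec in auto)
  note lag_real = lagrangian_real[folded lag_def]
  let ?xa = "avg x k" and ?ya = "avg y k" and ?\<kappa> = "1 / (2 * real k)"
  have xa: "?xa \<in> A" and ya: "?ya \<in> B"
    using average_gap(1,2)[OF k xs ys] by (auto simp: avg_def)
  have gap: "lag ?xa v - lag u ?ya \<le> ?\<kappa> * (L * (norm (x 0 - u))\<^sup>2 + 2 * (norm (y 0 - v))\<^sup>2)"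
    if "u \<in> A" "v \<in> B" for u v
    using average_gap(3)[OF k that] by (simp add: avg_def)
  define lstar where "lstar = lag xstar ystar"
  have saddle_lag: "lag xstar v \<le> lstar" "lstar \<le> lag u ystar" if "u \<in> A" "v \<in> B" for u v
    using saddle[OF that] by (auto simp: lag_def lstar_def)
  have params0: "L\<^sub>k 0 = L" "2 / \<rho>\<^sub>k 0 = 2" using params by (auto simp: \<rho>_def)

  have primal: "primal F H g ?xa - primal_opt F H g \<le> R"
    if R: "R = ereal ?\<kappa> * (ereal (L * (norm (x 0 - xstar))\<^sup>2)
            + ereal 2 * (ereal (norm (y 0)) + lipschitz_const H)\<^sup>2)" for R
  proof -
    have le: "ereal (lag ?xa v - lag xstar ?ya) \<le> R" if v: "v \<in> B" for v
    proof -
      \<comment> \<open>Fenchel-Young at \<open>v\<close> gives an affine minorant of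
        \<open>H\<close> with slope \<open>v\<close>, whence \<open>norm v\<close> is at most the
        Lipschitz constant.\<close>
      have "ereal (x \<bullet> v) \<le> H x + ereal (Hs v)" for x
      proof -
        have "ereal (x \<bullet> v) - H x \<le> ereal (Hs v)"
          unfolding Hs_real[OF v, symmetric] conjugate_def by (rule SUP_upper) simp
        then show ?thesis using H_pcc(1) by (cases "H x") (auto simp: proper_def)
      qed
      then have "ereal (norm v) \<le> lipschitz_const H" by (rule norm_le_lipschitz_const)
      then have "ereal ((norm (y 0) + norm v)\<^sup>2) \<le> (ereal (norm (y 0)) + lipschitz_const H)\<^sup>2"
        by (intro ereal_add_square_mono) auto
      moreover have "ereal ((norm (y 0 - v))\<^sup>2) \<le> ereal ((norm (y 0) + norm v)\<^sup>2)"
        using power2_norm_diff_le by simp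
      ultimately have *: "ereal ((norm (y 0 - v))\<^sup>2) \<le> (ereal (norm (y 0)) + lipschitz_const H)\<^sup>2"
        by (rule order_trans[rotated])
      have "ereal (lag ?xa v - lag xstar ?ya)
          \<le> ereal ?\<kappa> * (ereal (L * (norm (x 0 - xstar))\<^sup>2) + ereal 2 * ereal ((norm (y 0 - v))\<^sup>2))"
        using gap[OF xs v] by simp
      also have "\<dots> \<le> R"
        unfolding R using * by (intro ereal_mult_left_mono add_left_mono) auto
      finally show ?thesis .
    qed
    \<comment> \<open>An infinite \<open>R\<close> makes the claim trivial, and -infinity is
      excluded by \<open>le\<close> at \<open>ystar\<close>.\<close>
    show ?thesis
    proof (cases R)
      case (real r)
      \<comment> \<open>Weak duality, with the dual variable fixed at \<open>ystar\<close>.\<close>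
      have opt: "ereal lstar \<le> primal_opt F H g"
        unfolding primal_opt_def
      proof (rule INF_greatest)
        fix u show "ereal lstar \<le> primal F H g u"
        proof (cases "u \<in> A \<and> g u \<in> dom_ext H")
          case True
          then have u: "u \<in> A" and gu: "g u \<in> dom_ext H" by auto
          have "lstar \<le> f u + hr u + real_of_ereal (H (g u))"
            using saddle_lag(2)[OF u ys] fenchel_young[OF H_pcc(1) gu ys[unfolded B_def]]
            unfolding lag_def by (simp add: Hs_def)
          then have "ereal lstar \<le> F u + ereal (real_of_ereal (H (g u)))" by (simp add: F_real[OF u])
          then show ?thesis by (simp add: primal_def proper_finite[OF H_pcc(1) gu])
        next
          case False
          then have "primal F H g u = \<infinity>"
            using F_infty[of u] by (cases "u \<in> A") (auto simp: primal_def dom_ext_def F_real)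
          then show ?thesis by simp
        qed
      qed
      \<comment> \<open>Biconjugation turns the uniform bound over \<open>v\<close> into a bound on
        \<open>H\<close> at \<open>g ?xa\<close>.\<close>
      have "H (g ?xa) \<le> ereal (r + lag xstar ?ya - (f ?xa + hr ?xa))"
      proof (rule fenchel_moreau_le[OF H_pcc])
        fix v assume "v \<in> dom_ext (conjugate H)"
        then have "lag ?xa v - lag xstar ?ya \<le> r" using le[of v] real by (simp add: B_def)
        then show "g ?xa \<bullet> v - real_of_ereal (conjugate H v) \<le> r + lag xstar ?ya - (f ?xa + hr ?xa)"
          unfolding lag_def[of ?xa] by (simp add: Hs_def)
      qed
      then have "primal F H g ?xa \<le> F ?xa + ereal (r + lag xstar ?ya - (f ?xa + hr ?xa))"
        unfolding primal_def by (rule add_left_mono)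
      also have "\<dots> = ereal (r + lag xstar ?ya)" by (simp add: F_real[OF xa])
      also have "\<dots> \<le> ereal (r + lstar)" using saddle_lag(1)[OF xs ya] by simp
      finally have "primal F H g ?xa - primal_opt F H g \<le> ereal (r + lstar) - ereal lstar"
        using opt by (rule ereal_minus_mono)
      then show ?thesis using real by simp
    qed (use le[OF ys] in auto)
  qed

  have dual: "dual F H g ?ya - dual_opt F H g \<le> R"
    if R: "R = ereal ?\<kappa> * (ereal L * (ereal (norm (x 0)) + lipschitz_const (conjugate F))\<^sup>2
            + ereal (2 * (norm (y 0 - ystar))\<^sup>2))" for R
  proof -
    have le: "ereal (lag ?xa ystar - lag u ?ya) \<le> R" if u: "u \<in> A" for u
    proof -
      \<comment> \<open>The same argument with roles exchanged: \<open>u\<close> is the slope of an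
        affine minorant of \<open>conjugate F\<close>.\<close>
      have "ereal (z \<bullet> u) \<le> conjugate F z + ereal (f u + hr u)" for z
      proof -
        have "ereal (u \<bullet> z) - ereal (f u + hr u) \<le> conjugate F z"
          unfolding F_real[OF u, symmetric] conjugate_def by (rule SUP_upper) simp
        then show ?thesis by (cases "conjugate F z") (auto simp: inner_commute)
      qed
      then have "ereal (norm u) \<le> lipschitz_const (conjugate F)" by (rule norm_le_lipschitz_const)
      then have "ereal ((norm (x 0) + norm u)\<^sup>2) \<le> (ereal (norm (x 0)) + lipschitz_const (conjugate F))\<^sup>2"
        by (intro ereal_add_square_mono) auto
      moreover have "ereal ((norm (x 0 - u))\<^sup>2) \<le> ereal ((norm (x 0) + norm u)\<^sup>2)"
        using power2_norm_diff_le by simp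
      ultimately have *: "ereal ((norm (x 0 - u))\<^sup>2) \<le> (ereal (norm (x 0)) + lipschitz_const (conjugate F))\<^sup>2"
        by (rule order_trans[rotated])
      have "ereal (lag ?xa ystar - lag u ?ya)
          \<le> ereal ?\<kappa> * (ereal L * ereal ((norm (x 0 - u))\<^sup>2) + ereal (2 * (norm (y 0 - ystar))\<^sup>2))"
        using gap[OF u ys] by simp
      also have "\<dots> \<le> R"
        unfolding R using * L_pos by (intro ereal_mult_left_mono add_right_mono) auto
      finally show ?thesis .
    qed
    show ?thesis
    proof (cases R)
      case (real r)
      \<comment> \<open>Testing the supremum in \<open>dual_G\<close> at \<open>xstar\<close> bounds
        every dual value below by \<open>- lstar\<close>.\<close>
      have opt: "ereal (- lstar) \<le> dual_opt F H g"
        unfolding dual_opt_def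
      proof (rule INF_greatest)
        fix v
        have "ereal (- v \<bullet> g xstar) - F xstar \<le> dual_G F g (- v)"
          unfolding dual_G_def by (rule SUP_upper) simp
        then have G: "ereal (- v \<bullet> g xstar - (f xstar + hr xstar)) \<le> dual_G F g (- v)"
          by (simp add: F_real[OF xs])
        show "ereal (- lstar) \<le> dual F H g v"
        proof (cases "v \<in> B")
          case True
          have "ereal (- lstar) \<le> ereal (- v \<bullet> g xstar - (f xstar + hr xstar)) + ereal (Hs v)"
            using saddle_lag(1)[OF xs True] by (simp add: lag_def inner_commute)
          also have "\<dots> \<le> dual F H g v"
            unfolding dual_def Hs_real[OF True] using G by (rule add_right_mono)
          finally show ?thesis .
        next
          case False
          then show ?thesis using G by (simp add: dual_def Hs_infty)
        qed
      qed
      \<comment> \<open>\<open>dual_G\<close> is itself a supremum over \<open>u\<close>, so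
        \<open>le\<close> bounds it term by term; points outside \<open>A\<close> contribute
        -infinity.\<close>
      have "dual_G F g (- ?ya) \<le> ereal (r - lag ?xa ystar - Hs ?ya)"
        unfolding dual_G_def
      proof (rule SUP_least)
        fix u show "ereal (- ?ya \<bullet> g u) - F u \<le> ereal (r - lag ?xa ystar - Hs ?ya)"
        proof (cases "u \<in> A")
          case True
          then have "lag ?xa ystar - lag u ?ya \<le> r" using le[OF True] real by simp
          then show ?thesis by (simp add: F_real[OF True] lag_def[of u] inner_commute)
        next
          case False
          then show ?thesis by (simp add: F_infty)
        qed
      qed
      then have "dual F H g ?ya \<le> ereal (r - lag ?xa ystar - Hs ?ya) + ereal (Hs ?ya)"
        unfolding dual_def Hs_real[OF ya] by (rule add_right_mono)
      also have "\<dots> \<le> ereal (r - lstar)" using saddle_lag(2)[OF xa ys] by simp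
      finally have "dual F H g ?ya - dual_opt F H g \<le> ereal (r - lstar) - ereal (- lstar)"
        using opt by (rule ereal_minus_mono)
      then show ?thesis using real by simp
    qed (use le[OF xs] in auto)
  qed

  have "gap F H g X Y ?xa ?ya \<le> ereal ?\<kappa> *
      Sup {ereal (L * (norm (u - x 0))\<^sup>2 + 2 * (norm (v - y 0))\<^sup>2) | u v. u \<in> X \<and> v \<in> Y}"
    (is "_ \<le> ereal ?\<kappa> * Sup ?S")
    unfolding gap_def
  proof (rule Sup_least, clarify)
    fix u v assume uv: "u \<in> X" "v \<in> Y"
    then have mem: "u \<in> A" "v \<in> B" using X(3) Y(3) dom_F by (auto simp: B_def)
    have "lagrangian F H g ?xa v - lagrangian F H g u ?ya
        \<le> ereal ?\<kappa> * ereal (L * (norm (u - x 0))\<^sup>2 + 2 * (norm (v - y 0))\<^sup>2)"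
      using gap[OF mem] mem xa ya by (simp add: lag_real norm_minus_commute)
    also have "\<dots> \<le> ereal ?\<kappa> * Sup ?S"
      using uv by (intro ereal_mult_left_mono Sup_upper) auto
    finally show "lagrangian F H g ?xa v - lagrangian F H g u ?ya \<le> ereal ?\<kappa> * Sup ?S" .
  qed
  then show "primal F H g (avg x k) - primal_opt F H g
       \<le> ereal (1 / (2 * real k)) *
          (ereal (L\<^sub>k 0 * (norm (x 0 - xstar))\<^sup>2)
           + ereal (2 / \<rho>\<^sub>k 0) * (ereal (norm (y 0)) + lipschitz_const H)\<^sup>2)
   \<and> dual F H g (avg y k) - dual_opt F H g
       \<le> ereal (1 / (2 * real k)) *
          (ereal (L\<^sub>k 0) * (ereal (norm (x 0)) + lipschitz_const (conjugate F))\<^sup>2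
           + ereal (2 / \<rho>\<^sub>k 0 * (norm (y 0 - ystar))\<^sup>2))
   \<and> gap F H g X Y (avg x k) (avg y k)
       \<le> ereal (1 / (2 * real k)) *
          Sup {ereal (L\<^sub>k 0 * (norm (u - x 0))\<^sup>2 + 2 / \<rho>\<^sub>k 0 * (norm (v - y 0))\<^sup>2)
               | u v. u \<in> X \<and> v \<in> Y}"
    unfolding params0 using primal[OF refl] dual[OF refl] by blast
qed

end
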